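(* Let $\mathbb{K}$ be an algebraically closed field, let $G$ be a forest on the vertex set $[n]$, and let $d\geq 3$. Then the localized $\mathrm{v}$-number $\mathrm{v}_{\mathfrak{p}_{\emptyset}(G)}(L_G^{\mathbb{K}}(d))$ equals $v_d(G)$, the number of vertices of $G$ of degree at least $d$.
   Context: $[n]=\{1,\dots,n\}$ and $R=\mathbb{K}[x_{i,j}: i\in[n], j\in[d]]$ with the standard grading. The Lovász–Saks–Schrijver ideal of $G$ in dimension $d$ is $$L_G^{\mathbb{K}}(d)=\Big(\sum_{k=1}^d x_{i,k}x_{j,k} : \{i,j\}\in E(G)\Big)\subset R .$$ Its variety in $(\mathbb{K}^d)^n$ is $\mathrm{OR}_d(G)=\{(v_1,\dots,v_n)\in(\mathbb{K}^d)^n : v_i\cdot v_j=0 \text{ for all } \{i,j\}\in E(G)\}$, where $v\cdot w=\sum_k v_kw_k$. Let $U_G=\{(v_1,\dots,v_n)\in \mathrm{OR}_d(G): v_i\neq 0\text{ for all } i\in[n]\}$ and let $\mathfrak{p}_{\emptyset}(G)\subset R$ be the ideal of all polynomials vanishing on $U_G$; it is a minimal prime of $L_G^{\mathbb{K}}(d)$. For a graded ideal $I\subset R$ and $\mathfrak p\in\mathrm{Ass}(I)$, $\mathrm{v}_{\mathfrak p}(I)=\min\{e\ge 0:\exists f\in R_e \text{ with } I:f=\mathfrak p\}$. *)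

theory Defs
  imports
    "HOL-Library.Poly_Mapping"
    "HOL-Library.Extended_Nat"
    "HOL-Computational_Algebra.Polynomial"
    "HOL-Analysis.Finite_Cartesian_Product"
begin

section \<open>Simple graphs and forests\<close>

text \<open>
  A graph on the vertex set given by the finite type \<open>'n\<close> (so that \<open>CARD('n)\<close> plays the role
  of \<open>n\<close>) is given by its set of edges, each edge being a two-element set of vertices.
\<close>

definition simple_graph :: "'n set set \<Rightarrow> bool" where
  "simple_graph E \<longleftrightarrow> (\<forall>e\<in>E. card e = 2)"

definition graph_cycle :: "'n set set \<Rightarrow> 'n list \<Rightarrow> bool" where
  "graph_cycle E c \<longleftrightarrow> length c \<ge> 3 \<and> distinct c \<and>
     (\<forall>i < length c. {c ! i, c ! (Suc i mod length c)} \<in> E)"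

definition forest :: "'n set set \<Rightarrow> bool" where
  "forest E \<longleftrightarrow> simple_graph E \<and> (\<nexists>c. graph_cycle E c)"

definition vertex_degree :: "'n set set \<Rightarrow> 'n \<Rightarrow> nat" where
  "vertex_degree E i = card {j. {i, j} \<in> E}"

definition num_vertices_degree_ge :: "nat \<Rightarrow> 'n set set \<Rightarrow> nat" where
  "num_vertices_degree_ge m E = card {i. vertex_degree E i \<ge> m}"


section \<open>Multivariate polynomials\<close>

text \<open>
  Polynomials with variables indexed by \<open>'x\<close>: finitely supported coefficient functions on
  monomials, and monomials are finitely supported exponent functions.  The multiplication is the
  convolution product of \<open>Poly_Mapping\<close>.
\<close>

type_synonym ('x, 'k) mpoly = "('x \<Rightarrow>\<^sub>0 nat) \<Rightarrow>\<^sub>0 'k"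

definition mvar :: "'x \<Rightarrow> ('x, 'k::comm_ring_1) mpoly" where
  "mvar x = Poly_Mapping.single (Poly_Mapping.single x 1) 1"

definition mon_degree :: "('x \<Rightarrow>\<^sub>0 nat) \<Rightarrow> nat" where
  "mon_degree m = (\<Sum>x\<in>Poly_Mapping.keys m. Poly_Mapping.lookup m x)"

text \<open>The graded component of degree \<open>e\<close>; it contains \<open>0\<close>.\<close>

definition homogeneous_part :: "nat \<Rightarrow> ('x, 'k::comm_ring_1) mpoly set" where
  "homogeneous_part e = {f. \<forall>m\<in>Poly_Mapping.keys f. mon_degree m = e}"

definition mpoly_eval :: "('x \<Rightarrow> 'k) \<Rightarrow> ('x, 'k::comm_ring_1) mpoly \<Rightarrow> 'k" where
  "mpoly_eval a f = (\<Sum>m\<in>Poly_Mapping.keys f.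
     Poly_Mapping.lookup f m * (\<Prod>x\<in>Poly_Mapping.keys m. a x ^ Poly_Mapping.lookup m x))"


section \<open>Ideals and localized v-numbers\<close>

text \<open>
  The ideal generated by \<open>S\<close> is the span of \<open>S\<close> in the ring regarded as a module over itself.
\<close>

lemma module_times: "module ((*) :: 'a::comm_ring_1 \<Rightarrow> 'a \<Rightarrow> 'a)"
  by unfold_locales (simp_all add: algebra_simps)

definition ideal_generated :: "'a::comm_ring_1 set \<Rightarrow> 'a set" where
  "ideal_generated S = module.span (*) S"

definition colon_ideal :: "'a::comm_ring_1 set \<Rightarrow> 'a \<Rightarrow> 'a set" where
  "colon_ideal I f = {g. g * f \<in> I}"

text \<open>
  The minimum is taken in \<open>enat\<close>, so that the value is \<open>\<infinity>\<close> when no homogeneous \<open>f\<close> with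
  \<open>I : f = P\<close> exists; for an associated prime \<open>P\<close> of a graded ideal \<open>I\<close> it is finite.
\<close>

definition localized_v_number ::
  "('x, 'k::comm_ring_1) mpoly set \<Rightarrow> ('x, 'k) mpoly set \<Rightarrow> enat" where
  "localized_v_number P I = Inf {enat e | e. \<exists>f\<in>homogeneous_part e. colon_ideal I f = P}"


section \<open>Lovasz-Saks-Schrijver ideals\<close>

text \<open>
  Vertices range over \<open>'n\<close> and coordinates over \<open>'d\<close>, so the ambient ring \<open>R\<close> is the whole type
  \<open>('n \<times> 'd, 'k) mpoly\<close> and a point of \<open>(K\<^sup>d)\<^sup>n\<close> is an element of \<open>'k ^ 'd ^ 'n\<close>.
\<close>

definition lss_ideal :: "'n set set \<Rightarrow> ('n \<times> 'd::finite, 'k::comm_ring_1) mpoly set" where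
  "lss_ideal E =
     ideal_generated {(\<Sum>k\<in>UNIV. mvar (i, k) * mvar (j, k)) | i j. {i, j} \<in> E}"

text \<open>The bilinear form, without complex conjugation.\<close>

definition dot :: "'k::comm_ring_1 ^ 'd \<Rightarrow> 'k ^ 'd \<Rightarrow> 'k" where
  "dot v w = (\<Sum>k\<in>UNIV. v $ k * w $ k)"

definition orth_reps :: "'n::finite set set \<Rightarrow> ('k::comm_ring_1 ^ 'd ^ 'n) set" where
  "orth_reps E = {v. \<forall>i j. {i, j} \<in> E \<longrightarrow> dot (v $ i) (v $ j) = 0}"

definition nonzero_orth_reps :: "'n::finite set set \<Rightarrow> ('k::comm_ring_1 ^ 'd ^ 'n) set" where
  "nonzero_orth_reps E = {v \<in> orth_reps E. \<forall>i. v $ i \<noteq> 0}"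

definition vanishing_ideal ::
  "('k::comm_ring_1 ^ 'd ^ 'n) set \<Rightarrow> ('n \<times> 'd, 'k) mpoly set" where
  "vanishing_ideal V = {f. \<forall>v\<in>V. mpoly_eval (\<lambda>(i, k). v $ i $ k) f = 0}"

definition p_empty :: "'n::finite set set \<Rightarrow> ('n \<times> 'd::finite, 'k::comm_ring_1) mpoly set" where
  "p_empty E = vanishing_ideal (nonzero_orth_reps E)"

end

theory Submission
  imports Defs "HOL-Analysis.Determinants"
begin

text \<open>
  Let \<open>L\<close> be the ideal \<open>lss_ideal E\<close> and \<open>P\<close> the prime \<open>p_empty E\<close>, and call a vertex heavy if its
  degree is at least \<open>d\<close>.

  For every vertex \<open>i\<close> and coordinate \<open>k\<close>, the variable \<open>x\<^sub>i\<^sub>k\<close> is a nonzerodivisor on the part of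
  \<open>R/L\<close> of positive degree in the row \<open>i\<close>, and on all of \<open>R/L\<close> if \<open>i\<close> is not heavy. This goes by
  induction on the number of edges: an edge at \<open>i\<close> joins two components, so that the quotient ring is
  a tensor product of two independent parts modulo a single bilinear form, and that form is
  degenerated to a product of two coordinates by means of a torus action on one of the components.
  Hence \<open>L : (\<Prod>\<^sub>i x\<^sub>i\<^sub>k)\<^sup>\<infinity> = L : s\<close>, where \<open>s\<close> is the product of the \<open>x\<^sub>i\<^sub>k\<close> over the heavy vertices \<open>i\<close>.
  Eliminating leaves one by one shows that the left-hand side contains \<open>P\<close>; since \<open>P\<close> is prime,
  \<open>L : s = P\<close>, which is the upper bound.

  Conversely, let \<open>L : f = P\<close>. For a heavy vertex \<open>i\<close> the determinant of \<open>d\<close> of its neighbours lies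
  in \<open>P\<close> and does not involve \<open>i\<close>, so its product with the part of \<open>f\<close> not involving \<open>i\<close> lies
  in \<open>L\<close>. Setting the vector of \<open>i\<close> to zero shows that this part of \<open>f\<close> lies in \<open>P\<close>. As \<open>f\<close>
  itself does not, some monomial of \<open>f\<close> involves all heavy vertices.
\<close>

section \<open>Ideals\<close>

interpretation ideal_module: module "(*) :: 'a::comm_ring_1 \<Rightarrow> 'a \<Rightarrow> 'a"
  by (rule module_times)

(* This instance reassociates all products to the left and loops with mult_ac. *)
declare ideal_module.scale_scale [simp del]

lemma ideal_base: "x \<in> S \<Longrightarrow> x \<in> ideal_generated S"
  unfolding ideal_generated_def by (rule ideal_module.span_base)

lemma ideal_zero [simp]: "0 \<in> ideal_generated S"
  unfolding ideal_generated_def by (rule ideal_module.span_zero)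

lemma ideal_add: "x \<in> ideal_generated S \<Longrightarrow> y \<in> ideal_generated S \<Longrightarrow> x + y \<in> ideal_generated S"
  unfolding ideal_generated_def by (rule ideal_module.span_add)

lemma ideal_diff: "x \<in> ideal_generated S \<Longrightarrow> y \<in> ideal_generated S \<Longrightarrow> x - y \<in> ideal_generated S"
  unfolding ideal_generated_def by (rule ideal_module.span_diff)

lemma ideal_mult_left: "x \<in> ideal_generated S \<Longrightarrow> a * x \<in> ideal_generated S"
  unfolding ideal_generated_def by (rule ideal_module.span_scale)

lemma ideal_mult_right: "x \<in> ideal_generated S \<Longrightarrow> x * a \<in> ideal_generated S"
  using ideal_mult_left[of x S a] by (simp add: mult.commute)

lemma ideal_sum: "(\<And>i. i \<in> A \<Longrightarrow> f i \<in> ideal_generated S) \<Longrightarrow> sum f A \<in> ideal_generated S"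
  unfolding ideal_generated_def by (rule ideal_module.span_sum)

lemma ideal_mono: "S \<subseteq> T \<Longrightarrow> ideal_generated S \<subseteq> ideal_generated T"
  unfolding ideal_generated_def by (rule ideal_module.span_mono)

lemma ideal_insertE:
  assumes "x \<in> ideal_generated (insert a S)"
  obtains q j where "x = a * q + j" "j \<in> ideal_generated S"
proof -
  obtain k where "x - k * a \<in> ideal_generated S"
    using assms unfolding ideal_generated_def ideal_module.span_insert by blast
  then show ?thesis
    using that[of k "x - k * a"] by (simp add: mult.commute)
qed

text \<open>Elements of the ideal are sums of multiples \<open>a * s\<close>, and \<open>F\<close>
  respects sums. The operators below are linear but not multiplicative, so the hypothesis concerns
  all multiples of the generators, not just the generators.\<close>

lemma ideal_additive_image:
  assumes x: "x \<in> ideal_generated S"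
    and add: "\<And>x y. F (x + y) = F x + F y"
    and gen: "\<And>a s. s \<in> S \<Longrightarrow> F (a * s) \<in> ideal_generated T"
    and zero: "F 0 = 0"
  shows "F x \<in> ideal_generated T"
  using x unfolding ideal_generated_def
proof (induction rule: ideal_module.span_induct_alt)
  case base
  then show ?case using zero by (simp add: ideal_module.span_zero)
next
  case (step c x y)
  then show ?case
    using gen[of x c] by (simp add: add ideal_module.span_add ideal_generated_def)
qed


section \<open>Linear operators on polynomials\<close>

lemma poly_mapping_sum_single:
  fixes p :: "'m \<Rightarrow>\<^sub>0 'b::comm_monoid_add"
  shows "p = (\<Sum>m\<in>Poly_Mapping.keys p. Poly_Mapping.single m (Poly_Mapping.lookup p m))"
proof (rule poly_mapping_eqI)
  fix k
  show "Poly_Mapping.lookup p k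
      = Poly_Mapping.lookup (\<Sum>m\<in>Poly_Mapping.keys p. Poly_Mapping.single m (Poly_Mapping.lookup p m)) k"
    by (simp add: lookup_sum lookup_single when_def sum.delta in_keys_iff)
qed

text \<open>The monomials are those of the given polynomial, so a condition on its support
  (homogeneity, restricted variables) stays available in the \<open>single\<close> case.\<close>

lemma poly_mapping_keys_induct [consumes 0, case_names zero single add]:
  fixes p :: "'m \<Rightarrow>\<^sub>0 'b::comm_monoid_add"
  assumes zero: "P 0"
    and single: "\<And>m c. m \<in> Poly_Mapping.keys p \<Longrightarrow> P (Poly_Mapping.single m c)"
    and add: "\<And>p q. P p \<Longrightarrow> P q \<Longrightarrow> P (p + q)"
  shows "P p"
proof -
  have "P (\<Sum>m\<in>F. Poly_Mapping.single m (Poly_Mapping.lookup p m))"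
    if "finite F" "F \<subseteq> Poly_Mapping.keys p" for F
    using that
  proof (induction F)
    case empty
    then show ?case using zero by simp
  next
    case (insert x F)
    then show ?case by (simp add: single add)
  qed
  from this[of "Poly_Mapping.keys p"] show ?thesis
    by (simp flip: poly_mapping_sum_single)
qed

lemma poly_mapping_induct_add [case_names single add]:
  fixes p :: "'m \<Rightarrow>\<^sub>0 'b::comm_monoid_add"
  assumes single: "\<And>m c. P (Poly_Mapping.single m c)"
    and add: "\<And>p q. P p \<Longrightarrow> P q \<Longrightarrow> P (p + q)"
  shows "P p"
  using single[of undefined 0] by (induction p rule: poly_mapping_keys_induct) (simp_all add: single add)

text \<open>\<open>Poly_Mapping.single 0 c\<close> is the constant polynomial \<open>c\<close>: this
  is the K-linear map with prescribed values on monomials.\<close>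

definition linear_extension :: "('m \<Rightarrow> ('x, 'k::comm_ring_1) mpoly) \<Rightarrow> ('m \<Rightarrow>\<^sub>0 'k) \<Rightarrow> ('x, 'k) mpoly" where
  "linear_extension T p = (\<Sum>m\<in>Poly_Mapping.keys p. Poly_Mapping.single 0 (Poly_Mapping.lookup p m) * T m)"

lemma linear_extension_superset:
  assumes "finite F" "Poly_Mapping.keys p \<subseteq> F"
  shows "linear_extension T p = (\<Sum>m\<in>F. Poly_Mapping.single 0 (Poly_Mapping.lookup p m) * T m)"
  unfolding linear_extension_def
  by (rule sum.mono_neutral_left) (use assms in \<open>auto simp: in_keys_iff\<close>)

lemma linear_extension_add: "linear_extension T (p + q) = linear_extension T p + linear_extension T q"
proof -
  let ?F = "Poly_Mapping.keys p \<union> Poly_Mapping.keys q"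
  have "Poly_Mapping.keys (p + q) \<subseteq> ?F" by (rule keys_add)
  then show ?thesis
    by (simp add: linear_extension_superset[where F = ?F] lookup_add single_add distrib_right sum.distrib)
qed

lemma linear_extension_zero [simp]: "linear_extension T 0 = 0"
  by (simp add: linear_extension_def)

lemma linear_extension_uminus: "linear_extension T (- p) = - linear_extension T p"
  using linear_extension_add[of T p "- p"] by (simp add: eq_neg_iff_add_eq_0 add.commute)

lemma linear_extension_diff: "linear_extension T (p - q) = linear_extension T p - linear_extension T q"
  using linear_extension_add[of T p "- q"] by (simp add: linear_extension_uminus)

lemma linear_extension_sum: "linear_extension T (sum f A) = (\<Sum>i\<in>A. linear_extension T (f i))"
  by (induction A rule: infinite_finite_induct) (auto simp: linear_extension_add)

lemma linear_extension_single: "linear_extension T (Poly_Mapping.single m c) = Poly_Mapping.single 0 c * T m"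
  by (subst linear_extension_superset[of "{m}"]) auto

text \<open>By bilinearity the identity on monomials extends. There are two operators because
  multiplication by a homogeneous \<open>g\<close> shifts the degree selected by
  \<open>graded_part\<close>; for \<open>T1 = T2\<close> this is linearity over polynomials such as
  \<open>g\<close>.\<close>

lemma linear_extension_mult:
  assumes "\<And>m n. n \<in> Poly_Mapping.keys g \<Longrightarrow> T1 (m + n) = T2 m * Poly_Mapping.single n 1"
  shows "linear_extension T1 (p * g) = linear_extension T2 p * g"
proof -
  have mono: "linear_extension T1 (Poly_Mapping.single m c * Poly_Mapping.single n b)
      = linear_extension T2 (Poly_Mapping.single m c) * Poly_Mapping.single n b"
    if "n \<in> Poly_Mapping.keys g" for m n c b
  proof -
    have "linear_extension T1 (Poly_Mapping.single m c * Poly_Mapping.single n b)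
        = Poly_Mapping.single 0 (c * b) * (T2 m * Poly_Mapping.single n 1)"
      by (simp only: mult_single linear_extension_single assms[OF that])
    also have "\<dots> = T2 m * (Poly_Mapping.single 0 (c * b) * Poly_Mapping.single n 1)"
      by (rule mult.left_commute)
    also have "Poly_Mapping.single 0 (c * b) * Poly_Mapping.single n 1
        = Poly_Mapping.single 0 c * Poly_Mapping.single n b"
      by (simp add: mult_single)
    finally show ?thesis
      unfolding linear_extension_single by (simp only: mult.commute[of "T2 m"] mult.assoc)
  qed
  have "linear_extension T1 (p * Poly_Mapping.single n b) = linear_extension T2 p * Poly_Mapping.single n b"
    if "n \<in> Poly_Mapping.keys g" for n b
  proof (induction p rule: poly_mapping_induct_add)
    case (single m c)
    show ?case by (rule mono[OF that])
  next
    case (add p q)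
    then show ?case by (simp only: distrib_right linear_extension_add)
  qed
  then have "linear_extension T1 (p * (\<Sum>n\<in>Poly_Mapping.keys g. Poly_Mapping.single n (Poly_Mapping.lookup g n)))
      = linear_extension T2 p * (\<Sum>n\<in>Poly_Mapping.keys g. Poly_Mapping.single n (Poly_Mapping.lookup g n))"
    by (simp add: sum_distrib_left linear_extension_sum)
  then show ?thesis
    by (simp flip: poly_mapping_sum_single)
qed

lemma linear_extension_ideal:
  assumes "x \<in> ideal_generated S"
    and "\<And>a s. s \<in> S \<Longrightarrow> linear_extension T (a * s) \<in> ideal_generated U"
  shows "linear_extension T x \<in> ideal_generated U"
  by (rule ideal_additive_image[OF assms(1)]) (auto simp: linear_extension_add assms(2))


section \<open>Gradings\<close>

text \<open>Weights are integers because the torus action on a component of the forest uses both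
  signs.\<close>

definition weight_degree :: "('x::finite \<Rightarrow> int) \<Rightarrow> ('x \<Rightarrow>\<^sub>0 nat) \<Rightarrow> int" where
  "weight_degree w m = (\<Sum>x\<in>UNIV. int (Poly_Mapping.lookup m x) * w x)"

lemma weight_degree_add: "weight_degree w (m + n) = weight_degree w m + weight_degree w n"
  by (simp add: weight_degree_def lookup_add distrib_right sum.distrib)

lemma weight_degree_zero [simp]: "weight_degree w 0 = 0"
  by (simp add: weight_degree_def)

lemma weight_degree_single [simp]: "weight_degree w (Poly_Mapping.single x k) = int k * w x"
proof -
  have "weight_degree w (Poly_Mapping.single x k) = (\<Sum>y\<in>UNIV. if y = x then int k * w y else 0)"
    unfolding weight_degree_def by (rule sum.cong) (auto simp: lookup_single when_def)
  then show ?thesis by simp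
qed

definition weight_hom :: "('x::finite \<Rightarrow> int) \<Rightarrow> int \<Rightarrow> ('x, 'k::comm_ring_1) mpoly \<Rightarrow> bool" where
  "weight_hom w a p \<longleftrightarrow> (\<forall>m\<in>Poly_Mapping.keys p. weight_degree w m = a)"

definition graded_part :: "('x::finite \<Rightarrow> int) \<Rightarrow> int \<Rightarrow> ('x, 'k::comm_ring_1) mpoly \<Rightarrow> ('x, 'k) mpoly" where
  "graded_part w a = linear_extension (\<lambda>m. if weight_degree w m = a then Poly_Mapping.single m 1 else 0)"

lemma lookup_graded_part:
  "Poly_Mapping.lookup (graded_part w a p) m = (if weight_degree w m = a then Poly_Mapping.lookup p m else 0)"
proof (induction p rule: poly_mapping_induct_add)
  case (single n c)
  then show ?case
    by (auto simp: graded_part_def linear_extension_single mult_single lookup_single when_def)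
next
  case (add p q)
  then show ?case by (simp add: graded_part_def linear_extension_add lookup_add)
qed

lemma graded_part_add: "graded_part w a (p + q) = graded_part w a p + graded_part w a q"
  by (simp add: graded_part_def linear_extension_add)

lemma graded_part_diff: "graded_part w a (p - q) = graded_part w a p - graded_part w a q"
  by (simp add: graded_part_def linear_extension_diff)

lemma graded_part_sum: "graded_part w a (sum f A) = (\<Sum>i\<in>A. graded_part w a (f i))"
  by (simp add: graded_part_def linear_extension_sum)

lemma graded_part_zero [simp]: "graded_part w a 0 = 0"
  by (simp add: graded_part_def)

lemma weight_hom_graded_part: "weight_hom w a (graded_part w a p)"
  by (auto simp: weight_hom_def in_keys_iff lookup_graded_part split: if_splits)

lemma graded_part_weight_hom: "weight_hom w a p \<Longrightarrow> graded_part w b p = (if a = b then p else 0)"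
  by (rule poly_mapping_eqI) (auto simp: weight_hom_def lookup_graded_part in_keys_iff)

lemma weight_hom_graded_part_other: "weight_hom v b p \<Longrightarrow> weight_hom v b (graded_part w a p)"
  by (auto simp: weight_hom_def in_keys_iff lookup_graded_part split: if_splits)

lemma weight_hom_add: "weight_hom w a p \<Longrightarrow> weight_hom w a q \<Longrightarrow> weight_hom w a (p + q)"
  using keys_add[of p q] by (auto simp: weight_hom_def)

lemma weight_hom_zero [simp]: "weight_hom w a 0"
  by (simp add: weight_hom_def)

lemma weight_hom_one [simp]: "weight_hom w 0 1"
  by (simp add: weight_hom_def)

lemma weight_hom_uminus: "weight_hom w a p \<Longrightarrow> weight_hom w a (- p)"
  by (auto simp: weight_hom_def in_keys_iff)

lemma weight_hom_diff: "weight_hom w a p \<Longrightarrow> weight_hom w a q \<Longrightarrow> weight_hom w a (p - q)"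
  using weight_hom_add[of w a p "- q"] weight_hom_uminus[of w a q] by simp

lemma weight_hom_sum: "(\<And>i. i \<in> A \<Longrightarrow> weight_hom w a (f i)) \<Longrightarrow> weight_hom w a (sum f A)"
  by (induction A rule: infinite_finite_induct) (auto intro: weight_hom_add)

lemma weight_hom_mult: "weight_hom w a p \<Longrightarrow> weight_hom w b q \<Longrightarrow> weight_hom w (a + b) (p * q)"
  using keys_mult[of p q] by (fastforce simp: weight_hom_def weight_degree_add)

lemma weight_hom_mvar: "w x = a \<Longrightarrow> weight_hom w a (mvar x)"
  by (auto simp: weight_hom_def mvar_def)

lemma graded_part_mult:
  assumes "weight_hom w b g"
  shows "graded_part w a (p * g) = graded_part w (a - b) p * g"
  unfolding graded_part_def
  by (rule linear_extension_mult) (use assms in \<open>auto simp: weight_hom_def weight_degree_add mult_single\<close>)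

lemma graded_part_mult_left:
  assumes "weight_hom w b g"
  shows "graded_part w a (g * p) = g * graded_part w (a - b) p"
  using graded_part_mult[OF assms, of a p] by (simp add: mult.commute)

text \<open>The graded part of \<open>c * s\<close> is a graded part of \<open>c\<close> times the
  homogeneous generator \<open>s\<close>, so an ideal with homogeneous generators contains the parts
  of its elements.\<close>

lemma graded_part_ideal:
  assumes "x \<in> ideal_generated S" and "\<And>s. s \<in> S \<Longrightarrow> \<exists>b. weight_hom w b s"
  shows "graded_part w a x \<in> ideal_generated S"
  unfolding graded_part_def
proof (rule linear_extension_ideal[OF assms(1)], fold graded_part_def)
  fix c s assume "s \<in> S"
  then obtain b where "weight_hom w b s" using assms(2) by blast
  then show "graded_part w a (c * s) \<in> ideal_generated S"
    using \<open>s \<in> S\<close> by (simp add: graded_part_mult ideal_base ideal_mult_left)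
qed

lemma sum_graded_part: "(\<Sum>a\<in>weight_degree w ` Poly_Mapping.keys p. graded_part w a p) = p"
proof (rule poly_mapping_eqI)
  fix m
  have "Poly_Mapping.lookup (\<Sum>a\<in>weight_degree w ` Poly_Mapping.keys p. graded_part w a p) m
     = (\<Sum>a\<in>weight_degree w ` Poly_Mapping.keys p.
        if a = weight_degree w m then Poly_Mapping.lookup p m else 0)"
    unfolding lookup_sum by (rule sum.cong) (auto simp: lookup_graded_part)
  also have "\<dots> = Poly_Mapping.lookup p m"
    by (auto simp: sum.delta' in_keys_iff)
  finally show "Poly_Mapping.lookup (\<Sum>a\<in>weight_degree w ` Poly_Mapping.keys p. graded_part w a p) m
      = Poly_Mapping.lookup p m" .
qed

lemma mem_ideal_if_graded_parts:
  assumes "\<And>a. graded_part w a p \<in> ideal_generated S"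
  shows "p \<in> ideal_generated S"
  by (subst sum_graded_part[of w p, symmetric]) (rule ideal_sum, rule assms)


section \<open>Polynomials in a subset of the variables\<close>

definition polys_in :: "'x set \<Rightarrow> ('x, 'k::comm_ring_1) mpoly set" where
  "polys_in A = {p. \<forall>m\<in>Poly_Mapping.keys p. Poly_Mapping.keys m \<subseteq> A}"

lemma polys_in_add: "p \<in> polys_in A \<Longrightarrow> q \<in> polys_in A \<Longrightarrow> p + q \<in> polys_in A"
  using keys_add[of p q] by (auto simp: polys_in_def)

lemma polys_in_uminus: "p \<in> polys_in A \<Longrightarrow> - p \<in> polys_in A"
  by (auto simp: polys_in_def in_keys_iff)

lemma polys_in_zero [simp]: "0 \<in> polys_in A"
  by (simp add: polys_in_def)

lemma polys_in_one [simp]: "1 \<in> polys_in A"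
  by (simp add: polys_in_def)

lemma polys_in_mult: "p \<in> polys_in A \<Longrightarrow> q \<in> polys_in A \<Longrightarrow> p * q \<in> polys_in A"
  unfolding polys_in_def
proof (intro CollectI ballI)
  fix m
  assume pq: "p \<in> {p. \<forall>m\<in>Poly_Mapping.keys p. Poly_Mapping.keys m \<subseteq> A}"
    "q \<in> {p. \<forall>m\<in>Poly_Mapping.keys p. Poly_Mapping.keys m \<subseteq> A}"
  assume "m \<in> Poly_Mapping.keys (p * q)"
  then obtain a b where ab: "m = a + b" "a \<in> Poly_Mapping.keys p" "b \<in> Poly_Mapping.keys q"
    using keys_mult[of p q] by blast
  then have "Poly_Mapping.keys a \<subseteq> A" "Poly_Mapping.keys b \<subseteq> A"
    using pq by blast+
  then show "Poly_Mapping.keys m \<subseteq> A"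
    unfolding ab(1) using keys_add[of a b] by blast
qed

lemma polys_in_sum: "(\<And>i. i \<in> I \<Longrightarrow> f i \<in> polys_in A) \<Longrightarrow> sum f I \<in> polys_in A"
  by (induction I rule: infinite_finite_induct) (auto intro: polys_in_add)

lemma polys_in_prod: "(\<And>i. i \<in> I \<Longrightarrow> f i \<in> polys_in A) \<Longrightarrow> prod f I \<in> polys_in A"
  by (induction I rule: infinite_finite_induct) (auto intro: polys_in_mult)

lemma polys_in_power: "p \<in> polys_in A \<Longrightarrow> p ^ n \<in> polys_in A"
  by (induction n) (auto intro: polys_in_mult)

lemma polys_in_mvar: "x \<in> A \<Longrightarrow> mvar x \<in> polys_in A"
  by (simp add: polys_in_def mvar_def)

text \<open>Division by \<open>x\<close> on the monomials containing \<open>x\<close>, and zero on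
  the others, is linear over the polynomials without \<open>x\<close>. Hence it preserves the ideal,
  and it is left inverse to multiplication by \<open>mvar x\<close>.\<close>

lemma mvar_nonzero_divisor_ideal:
  assumes S: "S \<subseteq> polys_in (- {x})" and h: "mvar x * h \<in> ideal_generated S"
  shows "h \<in> ideal_generated S"
proof -
  define T :: "('a \<Rightarrow>\<^sub>0 nat) \<Rightarrow> ('a, 'b) mpoly" where
    "T = (\<lambda>m. if x \<in> Poly_Mapping.keys m then Poly_Mapping.single (m - Poly_Mapping.single x 1) 1 else 0)"
  have T: "T (m + n) = T m * Poly_Mapping.single n 1" if "x \<notin> Poly_Mapping.keys n" for m n
  proof (cases "x \<in> Poly_Mapping.keys m")
    case True
    have "m + n - Poly_Mapping.single x 1 = m - Poly_Mapping.single x 1 + n"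
      using that True
      by (intro poly_mapping_eqI) (auto simp: lookup_add lookup_minus lookup_single when_def in_keys_iff)
    then show ?thesis
      using True that by (simp add: T_def in_keys_iff lookup_add mult_single)
  next
    case False
    then show ?thesis using that by (simp add: T_def in_keys_iff lookup_add)
  qed
  have "linear_extension T (mvar x * h) = h"
  proof (induction h rule: poly_mapping_induct_add)
    case (single m c)
    have "x \<in> Poly_Mapping.keys (Poly_Mapping.single x 1 + m)"
      by (simp add: in_keys_iff lookup_add)
    then show ?case
      by (simp add: mvar_def mult_single linear_extension_single T_def)
  next
    case (add p q)
    then show ?case by (simp add: distrib_left linear_extension_add)
  qed
  moreover have "linear_extension T (mvar x * h) \<in> ideal_generated S"
  proof (rule linear_extension_ideal[OF h])
    fix a s assume s: "s \<in> S"
    have "linear_extension T (a * s) = linear_extension T a * s"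
      by (rule linear_extension_mult) (use s S T in \<open>auto simp: polys_in_def\<close>)
    then show "linear_extension T (a * s) \<in> ideal_generated S"
      using s by (simp add: ideal_base ideal_mult_left)
  qed
  ultimately show ?thesis by simp
qed

section \<open>Ideals in disjoint sets of variables\<close>

interpretation mpoly_vs: vector_space "\<lambda>(c::'k::field) (p::('x, 'k) mpoly). Poly_Mapping.single 0 c * p"
  by unfold_locales
    (simp_all add: distrib_left distrib_right single_add mult_single flip: mult.assoc)

interpretation mpoly_vs_pair: vector_space_pair
  "\<lambda>(c::'k::field) (p::('x, 'k) mpoly). Poly_Mapping.single 0 c * p"
  "\<lambda>(c::'k::field) (p::('x, 'k) mpoly). Poly_Mapping.single 0 c * p"
  by unfold_locales

text \<open>Over a field the ideal, as a subspace, is the image of a linear projection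
  \<open>g\<close>; take \<pi> to be the identity minus \<open>g\<close>. This chooses
  representatives of the residue classes linearly.\<close>

lemma ideal_complement_projection:
  fixes S :: "('x, 'k::field) mpoly set"
  obtains \<pi> where "\<And>p q. \<pi> (p + q) = \<pi> p + \<pi> q"
    and "\<And>c p. \<pi> (Poly_Mapping.single 0 c * p) = Poly_Mapping.single 0 c * \<pi> p"
    and "\<And>p. p \<in> ideal_generated S \<Longrightarrow> \<pi> p = 0"
    and "\<And>p. p - \<pi> p \<in> ideal_generated S"
proof -
  have sub: "mpoly_vs.subspace (ideal_generated S)"
    unfolding mpoly_vs.subspace_def by (auto intro: ideal_add ideal_mult_left)
  obtain g where g: "g ` UNIV \<subseteq> ideal_generated S"
    "Vector_Spaces.linear (\<lambda>c p. Poly_Mapping.single 0 c * p) (\<lambda>c p. Poly_Mapping.single 0 c * p) g"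
    "\<forall>v\<in>ideal_generated S. g v = v"
    using mpoly_vs_pair.linear_exists_left_inverse_on[OF mpoly_vs.linear_id sub] by auto
  interpret g: Vector_Spaces.linear "\<lambda>c p. Poly_Mapping.single 0 c * p" "\<lambda>c p. Poly_Mapping.single 0 c * p" g
    by (rule g(2))
  show ?thesis
  proof (rule that[of "\<lambda>p. p - g p"])
    show "(p + q) - g (p + q) = (p - g p) + (q - g q)" for p q
      by (simp add: g.add)
    show "Poly_Mapping.single 0 c * p - g (Poly_Mapping.single 0 c * p) = Poly_Mapping.single 0 c * (p - g p)" for c p
      by (simp only: g.scale right_diff_distrib)
    show "p - g p = 0" if "p \<in> ideal_generated S" for p
      using that g(3) by simp
    show "p - (p - g p) \<in> ideal_generated S" for p
      using g(1) by auto
  qed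
qed

section \<open>Splitting monomials along a set of variables\<close>

definition restrict_monomial :: "'x set \<Rightarrow> ('x \<Rightarrow>\<^sub>0 nat) \<Rightarrow> ('x \<Rightarrow>\<^sub>0 nat)" where
  "restrict_monomial A m = Poly_Mapping.mapp (\<lambda>x k. if x \<in> A then k else 0) m"

lemma lookup_restrict_monomial:
  "Poly_Mapping.lookup (restrict_monomial A m) x = (if x \<in> A then Poly_Mapping.lookup m x else 0)"
  by (auto simp: restrict_monomial_def lookup_mapp when_def in_keys_iff)

lemma restrict_monomial_add: "restrict_monomial A (m + n) = restrict_monomial A m + restrict_monomial A n"
  by (rule poly_mapping_eqI) (simp add: lookup_restrict_monomial lookup_add)

lemma restrict_monomial_inside: "Poly_Mapping.keys m \<subseteq> A \<Longrightarrow> restrict_monomial A m = m"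
  by (rule poly_mapping_eqI) (auto simp: lookup_restrict_monomial in_keys_iff)

lemma restrict_monomial_outside: "Poly_Mapping.keys m \<subseteq> - A \<Longrightarrow> restrict_monomial A m = 0"
  by (rule poly_mapping_eqI) (auto simp: lookup_restrict_monomial in_keys_iff)

lemma restrict_monomial_split: "restrict_monomial A m + restrict_monomial (- A) m = m"
  by (rule poly_mapping_eqI) (auto simp: lookup_restrict_monomial lookup_add)

text \<open>
  This replaces the tensor product \<open>K[A]/(S1) \<otimes> K[-A]/(S2)\<close>: the projection of \<open>K[A]\<close> along the
  ideal of \<open>S1\<close>, extended linearly over \<open>K[-A]\<close>, kills \<open>S1\<close> and preserves the ideal of \<open>S2\<close>.
\<close>

lemma ideal_disjoint_split:
  fixes S1 S2 :: "('x, 'k::field) mpoly set"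
  assumes S1: "S1 \<subseteq> polys_in A" and S2: "S2 \<subseteq> polys_in (- A)"
  obtains r where "q - r \<in> ideal_generated S1"
    and "\<And>z. z \<in> polys_in (- A) \<Longrightarrow> q * z \<in> ideal_generated (S1 \<union> S2) \<Longrightarrow> r * z \<in> ideal_generated S2"
proof -
  obtain \<pi> where add: "\<And>p q. \<pi> (p + q) = \<pi> p + \<pi> q"
    and scale: "\<And>c p. \<pi> (Poly_Mapping.single 0 c * p) = Poly_Mapping.single 0 c * \<pi> p"
    and ker: "\<And>p. p \<in> ideal_generated S1 \<Longrightarrow> \<pi> p = 0"
    and compl: "\<And>p. p - \<pi> p \<in> ideal_generated S1"
    using ideal_complement_projection[of S1] by metis
  define T where "T = (\<lambda>m. \<pi> (Poly_Mapping.single (restrict_monomial A m) 1)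
    * Poly_Mapping.single (restrict_monomial (- A) m) (1::'k))"
  have lin: "linear_extension T (p * z) = linear_extension T p * z" if z: "z \<in> polys_in (- A)" for p z
  proof (rule linear_extension_mult)
    fix m n assume "n \<in> Poly_Mapping.keys z"
    then have n: "Poly_Mapping.keys n \<subseteq> - A"
      using z by (auto simp: polys_in_def)
    show "T (m + n) = T m * Poly_Mapping.single n 1"
      unfolding T_def restrict_monomial_add restrict_monomial_outside[OF n] restrict_monomial_inside[OF n]
      by (simp add: mult_single mult.assoc)
  qed
  \<comment> \<open>A factor \<open>s\<close> in the variables of \<open>A\<close> stays inside
    \<pi>, because \<open>T\<close> applies \<pi> to the \<open>A\<close>-part of a monomial only.
    Hence \<open>T\<close> kills all multiples of \<open>S1\<close>.\<close>
  have mono: "linear_extension T (Poly_Mapping.single m c * s)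
      = \<pi> (Poly_Mapping.single (restrict_monomial A m) 1 * s)
        * Poly_Mapping.single (restrict_monomial (- A) m) c"
    if s: "s \<in> polys_in A" for m c s
  proof (induction s rule: poly_mapping_keys_induct)
    case zero
    then show ?case using ker[of 0] by simp
  next
    case (single n b)
    then have n: "Poly_Mapping.keys n \<subseteq> - (- A)"
      using s by (auto simp: polys_in_def)
    have rn: "restrict_monomial A n = n" "restrict_monomial (- A) n = 0"
      using n by (auto intro: restrict_monomial_inside restrict_monomial_outside)
    have sc: "\<pi> (Poly_Mapping.single k b) = Poly_Mapping.single 0 b * \<pi> (Poly_Mapping.single k 1)" for k
      using scale[of b "Poly_Mapping.single k 1"] by (simp add: mult_single)
    have "linear_extension T (Poly_Mapping.single m c * Poly_Mapping.single n b)
      = Poly_Mapping.single 0 (c * b) * (\<pi> (Poly_Mapping.single (restrict_monomial A m + n) 1)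
          * Poly_Mapping.single (restrict_monomial (- A) m) 1)"
      by (simp add: mult_single linear_extension_single T_def restrict_monomial_add rn)
    also have "\<dots> = \<pi> (Poly_Mapping.single (restrict_monomial A m + n) 1)
        * (Poly_Mapping.single 0 (c * b) * Poly_Mapping.single (restrict_monomial (- A) m) 1)"
      by (rule mult.left_commute)
    also have "Poly_Mapping.single 0 (c * b) * Poly_Mapping.single (restrict_monomial (- A) m) 1
        = Poly_Mapping.single 0 b * Poly_Mapping.single (restrict_monomial (- A) m) c"
      by (simp add: mult_single mult.commute)
    also have "\<pi> (Poly_Mapping.single (restrict_monomial A m + n) 1) * \<dots>
        = \<pi> (Poly_Mapping.single (restrict_monomial A m + n) b)
          * Poly_Mapping.single (restrict_monomial (- A) m) c"
      unfolding sc[of "restrict_monomial A m + n"] by (simp only: mult.assoc mult.left_commute)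
    finally show ?case by (simp add: mult_single)
  next
    case (add p q)
    then show ?case
      by (simp only: distrib_left linear_extension_add \<open>\<And>p q. \<pi> (p + q) = \<pi> p + \<pi> q\<close> distrib_right)
  qed
  have kill: "linear_extension T (a * s) = 0" if "s \<in> S1" for a s
  proof (induction a rule: poly_mapping_induct_add)
    case (single m c)
    have "Poly_Mapping.single (restrict_monomial A m) 1 * s \<in> ideal_generated S1"
      using that by (intro ideal_mult_left ideal_base)
    then show ?case
      using that S1 by (subst mono) (auto simp: ker)
  next
    case (add p q)
    then show ?case by (simp only: distrib_right linear_extension_add) simp
  qed
  show ?thesis
  proof (rule that[of "linear_extension T q"])
    show "q - linear_extension T q \<in> ideal_generated S1"
    proof (induction q rule: poly_mapping_induct_add)
      case (single m c)
      have "Poly_Mapping.single m c - linear_extension T (Poly_Mapping.single m c)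
        = (Poly_Mapping.single (restrict_monomial A m) 1 - \<pi> (Poly_Mapping.single (restrict_monomial A m) 1))
          * Poly_Mapping.single (restrict_monomial (- A) m) c"
        using mono[of 1 m c] by (simp add: left_diff_distrib mult_single restrict_monomial_split)
      then show ?case using compl ideal_mult_right by metis
    next
      case (add p q)
      then have "(p - linear_extension T p) + (q - linear_extension T q) \<in> ideal_generated S1"
        by (rule ideal_add)
      then show ?case by (simp add: linear_extension_add algebra_simps)
    qed
  next
    fix z assume z: "z \<in> polys_in (- A)" "q * z \<in> ideal_generated (S1 \<union> S2)"
    \<comment> \<open>Multiples of \<open>S1\<close> are killed and elements of \<open>S2\<close>
      pass through \<open>T\<close> as factors, so only the ideal of \<open>S2\<close>
      remains.\<close>
    have "linear_extension T (q * z) \<in> ideal_generated S2"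
    proof (rule linear_extension_ideal[OF z(2)])
      fix a s assume "s \<in> S1 \<union> S2"
      then show "linear_extension T (a * s) \<in> ideal_generated S2"
      proof
        assume "s \<in> S2"
        then show ?thesis
          using S2 by (subst lin) (auto intro: ideal_mult_left ideal_base)
      qed (simp add: kill)
    qed
    then show "linear_extension T q * z \<in> ideal_generated S2"
      by (simp add: lin[OF z(1)])
  qed
qed

section \<open>Forests\<close>

definition adj :: "'n set set \<Rightarrow> ('n \<times> 'n) set" where
  "adj E = {(a, b). {a, b} \<in> E}"

text \<open>Every edge is a bridge. This form passes to subgraphs at once and gives directly that
  the ends of a removed edge are disconnected.\<close>

definition acyclic_graph :: "'n set set \<Rightarrow> bool" where
  "acyclic_graph E \<longleftrightarrow> simple_graph E \<and> (\<forall>a b. {a, b} \<in> E \<longrightarrow> (a, b) \<notin> (adj (E - {{a, b}}))\<^sup>*)"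

lemma adj_mono: "E \<subseteq> F \<Longrightarrow> (adj E)\<^sup>* \<subseteq> (adj F)\<^sup>*"
  by (rule rtrancl_mono) (auto simp: adj_def)

lemma conn_sym: "(a, b) \<in> (adj E)\<^sup>* \<Longrightarrow> (b, a) \<in> (adj E)\<^sup>*"
proof -
  have "sym (adj E)" by (auto simp: sym_def adj_def insert_commute)
  then show "(a, b) \<in> (adj E)\<^sup>* \<Longrightarrow> (b, a) \<in> (adj E)\<^sup>*"
    using sym_rtrancl symE by metis
qed

lemma conn_step: "(a, b) \<in> (adj E)\<^sup>* \<Longrightarrow> {b, c} \<in> E \<Longrightarrow> (a, c) \<in> (adj E)\<^sup>*"
  by (rule rtrancl_into_rtrancl) (auto simp: adj_def)

lemma simple_graph_edgeE:
  assumes "simple_graph E" "e \<in> E"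
  obtains a b where "e = {a, b}" "a \<noteq> b"
  using assms by (metis card_2_iff simple_graph_def)

lemma simple_graph_neq: "simple_graph E \<Longrightarrow> {a, b} \<in> E \<Longrightarrow> a \<noteq> b"
  by (fastforce simp: simple_graph_def)

lemma acyclic_graph_neq: "acyclic_graph E \<Longrightarrow> {a, b} \<in> E \<Longrightarrow> a \<noteq> b"
  by (auto simp: acyclic_graph_def intro: simple_graph_neq)

lemma acyclic_graph_subset:
  assumes "acyclic_graph E" "F \<subseteq> E"
  shows "acyclic_graph F"
  unfolding acyclic_graph_def
proof (intro conjI allI impI)
  show "simple_graph F"
    using assms by (auto simp: acyclic_graph_def simple_graph_def)
  fix a b assume "{a, b} \<in> F"
  then show "(a, b) \<notin> (adj (F - {{a, b}}))\<^sup>*"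
    using assms adj_mono[of "F - {{a, b}}" "E - {{a, b}}"] by (auto simp: acyclic_graph_def)
qed

text \<open>When a step returns to a vertex already visited, the path is cut back to that
  vertex.\<close>

lemma rtrancl_distinct_path:
  assumes "(a, b) \<in> r\<^sup>*"
  shows "\<exists>xs. xs \<noteq> [] \<and> hd xs = a \<and> last xs = b \<and> distinct xs \<and>
    (\<forall>i. Suc i < length xs \<longrightarrow> (xs ! i, xs ! Suc i) \<in> r)"
  using assms
proof (induction rule: rtrancl_induct)
  case base
  show ?case by (rule exI[of _ "[a]"]) auto
next
  case (step y z)
  then obtain xs where xs: "xs \<noteq> []" "hd xs = a" "last xs = y" "distinct xs"
    "\<And>i. Suc i < length xs \<Longrightarrow> (xs ! i, xs ! Suc i) \<in> r" by blast
  show ?case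
  proof (cases "z \<in> set xs")
    case True
    then obtain k where k: "k < length xs" "xs ! k = z" by (auto simp: in_set_conv_nth)
    show ?thesis
    proof (rule exI[of _ "take (Suc k) xs"], intro conjI allI impI)
      show "last (take (Suc k) xs) = z"
        using k xs(1) by (simp add: take_Suc_conv_app_nth)
      show "hd (take (Suc k) xs) = a" using xs by simp
    qed (use xs k in auto)
  next
    case False
    show ?thesis
    proof (rule exI[of _ "xs @ [z]"], intro conjI allI impI)
      fix i assume i: "Suc i < length (xs @ [z])"
      show "((xs @ [z]) ! i, (xs @ [z]) ! Suc i) \<in> r"
      proof (cases "Suc i < length xs")
        case True
        then show ?thesis using xs(5)[of i] by (simp add: nth_append)
      next
        case F: False
        then have "i = length xs - 1" "Suc i = length xs" using i xs(1) by auto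
        then show ?thesis
          using step.hyps(2) xs(1,3) by (simp add: nth_append last_conv_nth)
      qed
    qed (use xs False in auto)
  qed
qed

text \<open>A second connection between the ends of an edge, taken without repetitions, closes up
  with that edge to a cycle.\<close>

lemma forest_acyclic_graph:
  assumes "forest E"
  shows "acyclic_graph E"
  unfolding acyclic_graph_def
proof (intro conjI allI impI notI)
  show sg: "simple_graph E" using assms by (simp add: forest_def)
  fix a b assume ab: "{a, b} \<in> E" "(a, b) \<in> (adj (E - {{a, b}}))\<^sup>*"
  have neq: "a \<noteq> b" using sg ab(1) by (rule simple_graph_neq)
  obtain xs where xs: "xs \<noteq> []" "hd xs = a" "last xs = b" "distinct xs"
    "\<And>i. Suc i < length xs \<Longrightarrow> (xs ! i, xs ! Suc i) \<in> adj (E - {{a, b}})"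
    using rtrancl_distinct_path[OF ab(2)] by blast
  have ends: "xs ! 0 = a" "xs ! (length xs - 1) = b"
    using xs by (auto simp: hd_conv_nth last_conv_nth)
  have "length xs \<noteq> 1" using neq ends by auto
  \<comment> \<open>A path with two vertices would be the removed edge itself.\<close>
  moreover have "length xs \<noteq> 2"
    using xs(5)[of 0] ends by (auto simp: adj_def)
  ultimately have len: "length xs \<ge> 3" using xs(1) by (cases "length xs") auto
  have "graph_cycle E xs"
    unfolding graph_cycle_def
  proof (intro conjI allI impI)
    fix i assume i: "i < length xs"
    show "{xs ! i, xs ! (Suc i mod length xs)} \<in> E"
    proof (cases "Suc i < length xs")
      case True
      then show ?thesis using xs(5)[of i] by (auto simp: adj_def)
    next
      case False
      then have "Suc i = length xs" "i = length xs - 1" using i by auto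
      then have "{xs ! i, xs ! (Suc i mod length xs)} = {a, b}" using ends by auto
      then show ?thesis using ab(1) by simp
    qed
  qed (use len xs in auto)
  then show False using assms by (auto simp: forest_def)
qed

text \<open>Walk away from \<open>z\<close>: delete \<open>{z, y}\<close> and continue from
  \<open>y\<close>. The leaf found there differs from \<open>y\<close>, and from \<open>z\<close>
  since \<open>z\<close> is now disconnected from \<open>y\<close>, so restoring the edge keeps it a
  leaf. The clauses \<open>c \<noteq> z\<close> and connectedness carry this induction.\<close>

lemma acyclic_graph_leaf_exists:
  fixes E :: "'n::finite set set"
  assumes "acyclic_graph E" "{z, y} \<in> E"
  shows "\<exists>c p. c \<noteq> z \<and> (z, c) \<in> (adj E)\<^sup>* \<and> {p, c} \<in> E \<and> (\<forall>e\<in>E. c \<in> e \<longrightarrow> e = {p, c})"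
  using assms
proof (induction "card E" arbitrary: E z y rule: less_induct)
  case less
  let ?F = "E - {{z, y}}"
  have neq: "z \<noteq> y" using less.prems acyclic_graph_neq by metis
  have zy: "(z, y) \<in> (adj E)\<^sup>*" using less.prems(2) by (auto simp: adj_def)
  have discon: "(z, y) \<notin> (adj ?F)\<^sup>*" using less.prems by (auto simp: acyclic_graph_def)
  show ?case
  proof (cases "\<exists>e\<in>?F. y \<in> e")
    case False
    then have "\<forall>e\<in>E. y \<in> e \<longrightarrow> e = {z, y}" by blast
    then show ?thesis using less.prems(2) neq zy by metis
  next
    case True
    then obtain e where e: "e \<in> ?F" "y \<in> e" by blast
    obtain a b where "e = {a, b}"
      using less.prems(1) e(1) simple_graph_edgeE[of E e] unfolding acyclic_graph_def by blast
    then obtain w where w: "{y, w} \<in> ?F"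
      using e by (cases "y = a") (auto simp: insert_commute)
    have "card ?F < card E" using less.prems(2) by (intro psubset_card_mono) auto
    moreover have "acyclic_graph ?F" using less.prems(1) by (rule acyclic_graph_subset) auto
    ultimately have "\<exists>c p. c \<noteq> y \<and> (y, c) \<in> (adj ?F)\<^sup>* \<and> {p, c} \<in> ?F \<and> (\<forall>e\<in>?F. c \<in> e \<longrightarrow> e = {p, c})"
      using w by (rule less.hyps)
    then obtain c p where c: "c \<noteq> y" "(y, c) \<in> (adj ?F)\<^sup>*" "{p, c} \<in> ?F"
      "\<forall>e\<in>?F. c \<in> e \<longrightarrow> e = {p, c}"
      by blast
    have "c \<noteq> z" using c(2) discon conn_sym by metis
    moreover have "(z, c) \<in> (adj E)\<^sup>*"
      using zy c(2) adj_mono[of ?F E] by (meson Diff_subset rtrancl_trans subsetD)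
    ultimately show ?thesis using c by blast
  qed
qed

text \<open>The vertex set is fixed, so stripping a leaf \<open>c\<close> leaves it behind as an
  isolated vertex.\<close>

lemma acyclic_graph_leaf_induct [consumes 1, case_names empty leaf]:
  fixes E :: "'n::finite set set"
  assumes "acyclic_graph E"
    and empty: "P {}"
    and leaf: "\<And>E p c. acyclic_graph E \<Longrightarrow> acyclic_graph (insert {p, c} E) \<Longrightarrow> p \<noteq> c
      \<Longrightarrow> (\<And>e. e \<in> E \<Longrightarrow> c \<notin> e) \<Longrightarrow> P E
      \<Longrightarrow> P (insert {p, c} E)"
  shows "P E"
  using assms(1)
proof (induction "card E" arbitrary: E rule: less_induct)
  case less
  show ?case
  proof (cases "E = {}")
    case True
    then show ?thesis using empty by simp
  next
    case False
    then obtain a b where "{a, b} \<in> E"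
      using less.prems simple_graph_edgeE unfolding acyclic_graph_def by (metis equals0I)
    then obtain c p where c: "{p, c} \<in> E" "\<forall>e\<in>E. c \<in> e \<longrightarrow> e = {p, c}"
      using acyclic_graph_leaf_exists[OF less.prems] by blast
    let ?F = "E - {{p, c}}"
    have E: "E = insert {p, c} ?F" using c(1) by (simp add: insert_absorb)
    have "card ?F < card E" using c(1) by (intro psubset_card_mono) auto
    moreover have F: "acyclic_graph ?F" using less.prems by (rule acyclic_graph_subset) auto
    ultimately have "P ?F" by (rule less.hyps)
    then have "P (insert {p, c} ?F)"
    proof (intro leaf[OF F])
      show "acyclic_graph (insert {p, c} ?F)" using less.prems E by simp
      show "p \<noteq> c" using less.prems c(1) acyclic_graph_neq by metis
      show "c \<notin> e" if "e \<in> ?F" for e using that c(2) by blast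
    qed
    then show ?thesis using E by simp
  qed
qed

text \<open>After removing an edge \<open>{z, y}\<close> the colourings started at \<open>z\<close>
  and at \<open>y\<close> live on different components, and their difference balances that edge. The
  result supplies torus weights for which edge polynomials have degree 0.\<close>

lemma acyclic_graph_two_colouring:
  fixes E :: "'n::finite set set"
  assumes "acyclic_graph E"
  shows "\<exists>\<sigma>::'n \<Rightarrow> int. \<sigma> z = 1 \<and> (\<forall>a b. {a, b} \<in> E \<longrightarrow> \<sigma> a + \<sigma> b = 0)
    \<and> (\<forall>v. (z, v) \<notin> (adj E)\<^sup>* \<longrightarrow> \<sigma> v = 0)"
  using assms
proof (induction "card E" arbitrary: E z rule: less_induct)
  case less
  show ?case
  proof (cases "\<exists>y. {z, y} \<in> E")
    case False
    then show ?thesis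
      by (intro exI[of _ "\<lambda>v. if v = z then 1 else 0"]) (auto simp: insert_commute)
  next
    case True
    then obtain y where y: "{z, y} \<in> E" by blast
    let ?F = "E - {{z, y}}"
    have card: "card ?F < card E" using y by (intro psubset_card_mono) auto
    have F: "acyclic_graph ?F" using less.prems by (rule acyclic_graph_subset) auto
    have discon: "(z, y) \<notin> (adj ?F)\<^sup>*"
      using less.prems y unfolding acyclic_graph_def by blast
    then have discon': "(y, z) \<notin> (adj ?F)\<^sup>*"
      using conn_sym[of y z ?F] by blast
    obtain \<sigma>1 where s1: "\<sigma>1 z = (1::int)" "\<And>a b. {a, b} \<in> ?F \<Longrightarrow> \<sigma>1 a + \<sigma>1 b = 0"
      "\<And>v. (z, v) \<notin> (adj ?F)\<^sup>* \<Longrightarrow> \<sigma>1 v = 0"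
      using less.hyps[OF card F, of z] by blast
    obtain \<sigma>2 where s2: "\<sigma>2 y = (1::int)" "\<And>a b. {a, b} \<in> ?F \<Longrightarrow> \<sigma>2 a + \<sigma>2 b = 0"
      "\<And>v. (y, v) \<notin> (adj ?F)\<^sup>* \<Longrightarrow> \<sigma>2 v = 0"
      using less.hyps[OF card F, of y] by blast
    have zy: "(z, y) \<in> (adj E)\<^sup>*" using y by (auto simp: adj_def)
    show ?thesis
    proof (intro exI[of _ "\<lambda>v. \<sigma>1 v - \<sigma>2 v"] conjI allI impI)
      show "\<sigma>1 z - \<sigma>2 z = 1" using s1(1) s2(3)[OF discon'] by simp
    next
      fix a b assume ab: "{a, b} \<in> E"
      show "\<sigma>1 a - \<sigma>2 a + (\<sigma>1 b - \<sigma>2 b) = 0"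
      proof (cases "{a, b} = {z, y}")
        case True
        then have "a = z \<and> b = y \<or> a = y \<and> b = z" by (auto simp: doubleton_eq_iff)
        then show ?thesis using s1(1) s2(1) s1(3)[OF discon] s2(3)[OF discon'] by auto
      next
        case False
        then have "{a, b} \<in> ?F" using ab by simp
        then show ?thesis using s1(2)[of a b] s2(2)[of a b] by linarith
      qed
    next
      fix v assume v: "(z, v) \<notin> (adj E)\<^sup>*"
      have "(z, v) \<notin> (adj ?F)\<^sup>*" using v adj_mono[of ?F E] by blast
      moreover have "(y, v) \<notin> (adj ?F)\<^sup>*"
        using v zy adj_mono[of ?F E] by (meson Diff_subset rtrancl_trans subsetD)
      ultimately show "\<sigma>1 v - \<sigma>2 v = 0" using s1(3) s2(3) by simp
    qed
  qed
qed

lemma vertex_degree_remove: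
  fixes E :: "'n::finite set set"
  assumes "{i, z} \<in> E"
  shows "vertex_degree E i = Suc (vertex_degree (E - {{i, z}}) i)"
proof -
  have "{j. {i, j} \<in> E} = insert z {j. {i, j} \<in> E - {{i, z}}}"
    using assms by (auto simp: doubleton_eq_iff)
  moreover have "z \<notin> {j. {i, j} \<in> E - {{i, z}}}" by simp
  ultimately show ?thesis by (simp add: vertex_degree_def)
qed

section \<open>Regularity of the coordinates of a vertex\<close>

definition edge_poly :: "'n \<Rightarrow> 'n \<Rightarrow> ('n \<times> 'd::finite, 'k::comm_ring_1) mpoly" where
  "edge_poly i j = (\<Sum>k\<in>UNIV. mvar (i, k) * mvar (j, k))"

definition edge_polys :: "'n set set \<Rightarrow> ('n \<times> 'd::finite, 'k::comm_ring_1) mpoly set" where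
  "edge_polys E = {edge_poly i j | i j. {i, j} \<in> E}"

lemma lss_ideal_edge_polys: "lss_ideal E = ideal_generated (edge_polys E)"
  by (simp add: lss_ideal_def edge_polys_def edge_poly_def)

lemma edge_poly_commute: "edge_poly i j = edge_poly j i"
  by (simp add: edge_poly_def mult.commute)

lemma edge_polys_mono: "E \<subseteq> F \<Longrightarrow> edge_polys E \<subseteq> edge_polys F"
  by (auto simp: edge_polys_def)

lemma edge_polys_insert: "edge_polys (insert {i, z} E) = insert (edge_poly i z) (edge_polys E)"
  unfolding edge_polys_def by (auto simp: doubleton_eq_iff edge_poly_commute)

lemma edge_poly_polys_in:
  "(\<And>k. (i, k) \<in> A) \<Longrightarrow> (\<And>k. (j, k) \<in> A) \<Longrightarrow> edge_poly i j \<in> polys_in A"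
  unfolding edge_poly_def by (intro polys_in_sum polys_in_mult polys_in_mvar) auto

lemma weight_hom_edge_poly:
  assumes "\<And>k. w (i, k) + w (j, k) = a"
  shows "weight_hom w a (edge_poly i j)"
  unfolding edge_poly_def
proof (rule weight_hom_sum)
  fix k
  show "weight_hom w a (mvar (i, k) * mvar (j, k))"
    unfolding assms[of k, symmetric] by (intro weight_hom_mult weight_hom_mvar refl)
qed

definition row_weight :: "'n \<Rightarrow> 'n \<times> 'd \<Rightarrow> int" where
  "row_weight i = (\<lambda>(j, k). if j = i then 1 else 0)"

lemma row_weight_apply [simp]: "row_weight i (j, k) = (if j = i then 1 else 0)"
  by (simp add: row_weight_def)

lemma row_weight_nonneg: "0 \<le> weight_degree (row_weight i) m"
  unfolding weight_degree_def by (rule sum_nonneg) (auto simp: row_weight_def split: prod.splits)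

lemma weight_hom_row_edge_poly: "\<exists>b. weight_hom (row_weight v) b (edge_poly i j)"
proof -
  have "weight_hom (row_weight v) ((if i = v then 1 else 0) + (if j = v then 1 else 0)) (edge_poly i j)"
    by (rule weight_hom_edge_poly) auto
  then show ?thesis by blast
qed

text \<open>
  Adding the variables outside \<open>C\<close> amounts to giving the vertex \<open>i\<close> only the coordinates in \<open>C\<close>.
\<close>

definition trunc_gens ::
  "'n set set \<Rightarrow> 'n \<Rightarrow> 'd set \<Rightarrow> ('n \<times> 'd::finite, 'k::comm_ring_1) mpoly set" where
  "trunc_gens E i C = edge_polys E \<union> {mvar (i, l) | l. l \<notin> C}"

lemma trunc_gens_UNIV: "trunc_gens E i UNIV = edge_polys E"
  by (simp add: trunc_gens_def)

lemma trunc_gens_remove: "k \<in> C \<Longrightarrow> trunc_gens E i (C - {k}) = insert (mvar (i, k)) (trunc_gens E i C)"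
  by (auto simp: trunc_gens_def)

lemma trunc_gens_insert:
  "trunc_gens (insert {i, z} E) v C = insert (edge_poly i z) (trunc_gens E v C)"
  by (simp add: trunc_gens_def edge_polys_insert)

lemma weight_hom_row_trunc_gens: "s \<in> trunc_gens E i C \<Longrightarrow> \<exists>b. weight_hom (row_weight v) b s"
  unfolding trunc_gens_def edge_polys_def using weight_hom_row_edge_poly weight_hom_mvar by fast

text \<open>Every monomial of positive degree in the row is divisible by one of its
  variables.\<close>

lemma row_positive_in_ideal:
  fixes q :: "('n::finite \<times> 'd::finite, 'k::comm_ring_1) mpoly"
  assumes q: "weight_hom (row_weight i) e q" and e: "e \<ge> 1"
    and S: "\<And>l. mvar (i, l) \<in> S"
  shows "q \<in> ideal_generated S"
proof (induction q rule: poly_mapping_keys_induct)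
  case (single m c)
  then have "weight_degree (row_weight i) m \<noteq> 0" using q e by (auto simp: weight_hom_def)
  then obtain x where x: "Poly_Mapping.lookup m x \<noteq> 0" "row_weight i x \<noteq> 0"
    unfolding weight_degree_def by (metis (mono_tags, lifting) mult_eq_0_iff of_nat_0 sum.neutral)
  obtain l where l: "x = (i, l)"
    using x(2) by (cases x) (auto split: if_splits)
  have "Poly_Mapping.single x 1 + (m - Poly_Mapping.single x 1) = m"
    using x(1) by (intro poly_mapping_eqI) (auto simp: lookup_add lookup_minus lookup_single when_def)
  then have "Poly_Mapping.single m c = mvar x * Poly_Mapping.single (m - Poly_Mapping.single x 1) c"
    by (simp add: mvar_def mult_single)
  then show ?case
    using S[of l] l by (simp add: ideal_base ideal_mult_right)
qed (auto intro: ideal_add)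

text \<open>A multiple of a coordinate of \<open>z\<close> has components of positive row degree
  only, so cancellation for homogeneous elements of positive degree carries over to it.\<close>

lemma row_regular_mult:
  fixes S :: "('n::finite \<times> 'd::finite, 'k::comm_ring_1) mpoly set"
  assumes reg: "\<And>e h. weight_hom (row_weight z) e h \<Longrightarrow> e \<ge> 1 \<Longrightarrow> mvar (z, k) * h \<in> ideal_generated S
      \<Longrightarrow> h \<in> ideal_generated S"
    and hom: "\<And>s. s \<in> S \<Longrightarrow> \<exists>b. weight_hom (row_weight z) b s"
    and mem: "mvar (z, k) * (mvar (z, l) * r) \<in> ideal_generated S"
  shows "mvar (z, l) * r \<in> ideal_generated S"
proof (rule mem_ideal_if_graded_parts)
  fix a
  have hv: "weight_hom (row_weight z) 1 (mvar (z, l) :: ('n \<times> 'd, 'k) mpoly)" for l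
    by (rule weight_hom_mvar) simp
  have "graded_part (row_weight z) (a + 1) (mvar (z, k) * (mvar (z, l) * r)) \<in> ideal_generated S"
    using mem hom by (rule graded_part_ideal)
  then have m: "mvar (z, k) * (mvar (z, l) * graded_part (row_weight z) (a - 1) r) \<in> ideal_generated S"
    by (simp add: graded_part_mult_left[OF hv])
  have c: "graded_part (row_weight z) a (mvar (z, l) * r) = mvar (z, l) * graded_part (row_weight z) (a - 1) r"
    by (rule graded_part_mult_left[OF hv])
  show "graded_part (row_weight z) a (mvar (z, l) * r) \<in> ideal_generated S"
  proof (cases "a \<ge> 1")
    case True
    show ?thesis
      unfolding c by (rule reg[OF _ True m], fold c) (rule weight_hom_graded_part)
  next
    case False
    \<comment> \<open>For \<open>a \<le> 0\<close> the cofactor would have the negative row degree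
      \<open>a - 1\<close>.\<close>
    then have "weight_degree (row_weight z) n \<noteq> a - 1" for n :: "'n \<times> 'd \<Rightarrow>\<^sub>0 nat"
      using row_weight_nonneg[of z n] by linarith
    then have "graded_part (row_weight z) (a - 1) r = 0"
      by (intro poly_mapping_eqI) (simp add: lookup_graded_part)
    then show ?thesis by (simp add: c)
  qed
qed

lemma graded_part_eventually_zero:
  fixes q :: "('x::finite, 'k::comm_ring_1) mpoly"
  obtains M where "\<And>s. s > M \<Longrightarrow> graded_part w s q = 0"
proof -
  obtain M where M: "\<And>m. m \<in> Poly_Mapping.keys q \<Longrightarrow> weight_degree w m \<le> M"
    using bdd_above_finite[of "weight_degree w ` Poly_Mapping.keys q"] by (auto simp: bdd_above_def)
  have "graded_part w s q = 0" if "s > M" for s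
  proof (rule poly_mapping_eqI)
    fix m
    show "Poly_Mapping.lookup (graded_part w s q) m = Poly_Mapping.lookup 0 m"
      using M[of m] that by (cases "m \<in> Poly_Mapping.keys q") (auto simp: lookup_graded_part in_keys_iff)
  qed
  then show ?thesis by (rule that)
qed

text \<open>
  Remove an edge \<open>{i, z}\<close>. Modulo the coordinate \<open>k\<close> of \<open>i\<close>, the edge polynomial annihilates its
  cofactor \<open>q\<close>; the grading by the weights \<open>w\<close>, which exists since the two ends are now
  disconnected, reduces this to products \<open>mvar (i, k') * mvar (z, k')\<close> of two coordinates.
\<close>

lemma row_regular:
  fixes E :: "'n::finite set set" and h :: "('n \<times> 'd::finite, 'k::field) mpoly"
  assumes "acyclic_graph E" "k \<in> C" "weight_hom (row_weight i) e h"
    and "e \<ge> 1 \<or> vertex_degree E i < card C"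
    and "mvar (i, k) * h \<in> ideal_generated (trunc_gens E i C)"
  shows "h \<in> ideal_generated (trunc_gens E i C)"
  using assms
proof (induction "card E" arbitrary: E i C k e h rule: less_induct)
  case less
  note E = less.prems(1) and k = less.prems(2) and h = less.prems(3) and dim = less.prems(4)
    and xh = less.prems(5)
  show ?case
  proof (cases "\<exists>z. {i, z} \<in> E")
    case False
    \<comment> \<open>Without edges at \<open>i\<close>, and as \<open>k\<close> is in
      \<open>C\<close>, no generator involves the variable \<open>(i, k)\<close>.\<close>
    have "trunc_gens E i C \<subseteq> polys_in (- {(i, k)})"
      unfolding trunc_gens_def edge_polys_def
      using False k
      by (auto intro!: edge_poly_polys_in polys_in_mvar simp: insert_commute)
    then show ?thesis using xh by (rule mvar_nonzero_divisor_ideal)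
  next
    case True
    then obtain z where z: "{i, z} \<in> E" by blast
    define F where "F = E - {{i, z}}"
    have E_eq: "E = insert {i, z} F" using z by (auto simp: F_def)
    have iz: "i \<noteq> z" using E z acyclic_graph_neq by metis
    have card: "card F < card E" using z unfolding F_def by (intro psubset_card_mono) auto
    have F: "acyclic_graph F" using E unfolding F_def by (rule acyclic_graph_subset) auto
    have deg: "vertex_degree E i = Suc (vertex_degree F i)"
      using vertex_degree_remove[OF z] by (simp add: F_def)
    define Z where "Z = {v. (z, v) \<in> (adj F)\<^sup>*}"
    have iZ: "i \<notin> Z"
    proof
      assume "i \<in> Z"
      then have "(i, z) \<in> (adj F)\<^sup>*" by (simp add: Z_def conn_sym)
      then show False using E z by (auto simp: acyclic_graph_def F_def)
    qed
    have zZ: "z \<in> Z" by (simp add: Z_def)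
    have Z_edge: "a \<in> Z \<longleftrightarrow> b \<in> Z" if "{a, b} \<in> F" for a b
      using that conn_step[of z a F b] conn_step[of z b F a] by (auto simp: Z_def insert_commute)

    define l :: "('n \<times> 'd, 'k) mpoly" where "l = edge_poly i z"
    have hl: "weight_hom (row_weight i) 1 l"
      unfolding l_def by (rule weight_hom_edge_poly) (use iz in auto)
    have hx: "weight_hom (row_weight i) 1 (mvar (i, k) :: ('n \<times> 'd, 'k) mpoly)" for k
      by (rule weight_hom_mvar) simp
    define I0 where "I0 = ideal_generated (trunc_gens F i C :: ('n \<times> 'd, 'k) mpoly set)"
    define I1 where "I1 = ideal_generated (trunc_gens F i (C - {k}) :: ('n \<times> 'd, 'k) mpoly set)"
    have I01: "I0 \<subseteq> I1"
      unfolding I0_def I1_def by (rule ideal_mono) (use k in \<open>simp add: trunc_gens_remove subset_insertI\<close>)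
    have xI1: "mvar (i, k) \<in> I1"
      unfolding I1_def by (rule ideal_base) (use k in \<open>simp add: trunc_gens_remove\<close>)
    have graded_part_I0: "graded_part (row_weight i) a p \<in> I0" if "p \<in> I0" for a p
      using that weight_hom_row_trunc_gens unfolding I0_def by (rule graded_part_ideal)

    obtain q0 j0 where qj0: "mvar (i, k) * h = l * q0 + j0" "j0 \<in> I0"
    proof -
      have "mvar (i, k) * h \<in> ideal_generated (insert l (trunc_gens F i C))"
        using xh by (simp add: E_eq trunc_gens_insert l_def)
      then show ?thesis using that unfolding I0_def by (rule ideal_insertE)
    qed
    \<comment> \<open>Only row degree \<open>e + 1\<close> of the equation matters; as
      \<open>l\<close> has row degree 1, the cofactor is cut down to degree
      \<open>e\<close>.\<close>
    define q where "q = graded_part (row_weight i) e q0"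
    define j where "j = graded_part (row_weight i) (e + 1) j0"
    have hq: "weight_hom (row_weight i) e q" unfolding q_def by (rule weight_hom_graded_part)
    have j: "j \<in> I0" unfolding j_def by (rule graded_part_I0) (rule qj0(2))
    have qj: "mvar (i, k) * h = l * q + j"
    proof -
      have "graded_part (row_weight i) (e + 1) (mvar (i, k) * h) = mvar (i, k) * h"
        using graded_part_weight_hom[OF weight_hom_mult[OF hx h]] by simp
      then show ?thesis
        unfolding qj0(1) by (simp add: graded_part_add graded_part_mult_left[OF hl] q_def j_def)
    qed
    have lq: "l * q \<in> I1"
    proof -
      have "mvar (i, k) * h - j \<in> I1"
        unfolding I1_def using xI1 j I01 by (intro ideal_diff ideal_mult_right) (auto simp: I1_def)
      then show ?thesis by (simp add: qj)
    qed

    \<comment> \<open>\<open>A\<close> holds the variables outside the component of \<open>z\<close>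
      in \<open>F\<close>. The truncating variables of \<open>i\<close> go to \<open>S1\<close>, so
      \<open>S2\<close> consists of plain edge polynomials.\<close>
    define A where "A = {(v, m :: 'd). v \<notin> Z}"
    define S1 :: "('n \<times> 'd, 'k) mpoly set" where
      "S1 = edge_polys {f \<in> F. f \<subseteq> - Z} \<union> {mvar (i, m) | m. m \<notin> C - {k}}"
    define S2 :: "('n \<times> 'd, 'k) mpoly set" where "S2 = edge_polys {f \<in> F. f \<subseteq> Z}"
    have S12: "S1 \<union> S2 = trunc_gens F i (C - {k})"
    proof -
      have "F = {f \<in> F. f \<subseteq> - Z} \<union> {f \<in> F. f \<subseteq> Z}"
      proof -
        have "f \<subseteq> - Z \<or> f \<subseteq> Z" if f: "f \<in> F" for f
        proof -
          obtain a b where "f = {a, b}"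
            using F f simple_graph_edgeE unfolding acyclic_graph_def by metis
          then show ?thesis using Z_edge[of a b] f by auto
        qed
        then show ?thesis by auto
      qed
      then have "edge_polys F = edge_polys {f \<in> F. f \<subseteq> - Z}
          \<union> (edge_polys {f \<in> F. f \<subseteq> Z} :: ('n \<times> 'd, 'k) mpoly set)"
        unfolding edge_polys_def by blast
      then show ?thesis unfolding S1_def S2_def trunc_gens_def by auto
    qed
    have S1: "S1 \<subseteq> polys_in A"
      unfolding S1_def edge_polys_def A_def using iZ
      by (auto intro!: edge_poly_polys_in polys_in_mvar)
    have S2: "S2 \<subseteq> polys_in (- A)"
      unfolding S2_def edge_polys_def A_def by (auto intro!: edge_poly_polys_in)
    have zA: "mvar (z, m) \<in> polys_in (- A)" for m
      by (rule polys_in_mvar) (simp add: A_def zZ)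
    have S1I: "ideal_generated S1 \<subseteq> I1" unfolding I1_def S12[symmetric] by (rule ideal_mono) simp
    have S2F: "ideal_generated S2 \<subseteq> ideal_generated (edge_polys F)"
      unfolding S2_def by (intro ideal_mono edge_polys_mono) auto
    have F_I0: "ideal_generated (edge_polys F) \<subseteq> I0"
      unfolding I0_def by (rule ideal_mono) (simp add: trunc_gens_def)

    have zq: "mvar (z, m) * q \<in> I1" for m
    proof (cases "C - {k} = {}")
      case True
      \<comment> \<open>As \<open>i\<close> has an edge, \<open>vertex_degree E i < card C\<close>
        fails and \<open>e\<close> must be positive. With no coordinate left, all variables of
        \<open>i\<close> generate \<open>I1\<close>.\<close>
      then have "card C \<le> 1" using card_mono[of "{k}" C] by auto
      then have "e \<ge> 1" using dim deg by linarith
      then have "q \<in> I1"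
        unfolding I1_def using hq True by (intro row_positive_in_ideal) (auto simp: trunc_gens_def)
      then show ?thesis unfolding I1_def by (rule ideal_mult_left)
    next
      case False
      then obtain k' where k': "k' \<in> C - {k}" by blast
      \<comment> \<open>Passing to \<open>F\<close> and \<open>C - {k}\<close> costs one edge at
        \<open>i\<close> and one coordinate, so the bound is preserved.\<close>
      have dim': "e \<ge> 1 \<or> vertex_degree F i < card (C - {k})"
        using dim deg k by auto
      obtain \<sigma> :: "'n \<Rightarrow> int" where s: "\<sigma> z = 1" "\<And>a b. {a, b} \<in> F \<Longrightarrow> \<sigma> a + \<sigma> b = 0"
        "\<And>v. v \<notin> Z \<Longrightarrow> \<sigma> v = 0"
        using acyclic_graph_two_colouring[OF F, of z] unfolding Z_def by blast
      \<comment> \<open>The torus acts on the coordinate \<open>k'\<close> alone, with alternating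
        signs on the component of \<open>z\<close>. The generators are homogeneous, while in
        \<open>l\<close> only the term of \<open>k'\<close> has weight 1 and all others have weight
        0.\<close>
      define w :: "'n \<times> 'd \<Rightarrow> int" where "w = (\<lambda>(v, m). if m = k' then \<sigma> v else 0)"
      have w_gens: "\<exists>b. weight_hom w b s" if "s \<in> trunc_gens F i (C - {k})" for s :: "('n \<times> 'd, 'k) mpoly"
      proof -
        have "weight_hom w 0 (edge_poly a b :: ('n \<times> 'd, 'k) mpoly)" if "{a, b} \<in> F" for a b
          by (rule weight_hom_edge_poly) (use s(2)[OF that] in \<open>simp add: w_def\<close>)
        then show ?thesis
          using that weight_hom_mvar unfolding trunc_gens_def edge_polys_def by fast
      qed
      have w_xz: "weight_hom w (if m = k' then 1 else 0) (mvar (i, m) * mvar (z, m) :: ('n \<times> 'd, 'k) mpoly)" for m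
      proof -
        have "weight_hom w (w (i, m) + w (z, m)) (mvar (i, m) * mvar (z, m) :: ('n \<times> 'd, 'k) mpoly)"
          by (intro weight_hom_mult weight_hom_mvar refl)
        moreover have "w (i, m) + w (z, m) = (if m = k' then 1 else 0)"
          using s(1) s(3)[OF iZ] by (simp add: w_def)
        ultimately show ?thesis by simp
      qed
      \<comment> \<open>One coordinate of \<open>z\<close> annihilating \<open>r\<close> forces all
        of them to do so: \<open>mvar (z, m) * r\<close> has positive degree in row
        \<open>z\<close>, where the induction hypothesis for \<open>F\<close> cancels
        \<open>mvar (z, k')\<close>.\<close>
      have swap: "mvar (z, m) * r \<in> ideal_generated (edge_polys F)"
        if r: "r * mvar (z, k') \<in> ideal_generated (edge_polys F)" for r :: "('n \<times> 'd, 'k) mpoly" and m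
      proof (rule row_regular_mult)
        show "mvar (z, k') * (mvar (z, m) * r) \<in> ideal_generated (edge_polys F)"
          using ideal_mult_left[OF r, of "mvar (z, m)"] by (simp add: mult_ac)
        show "p \<in> ideal_generated (edge_polys F)"
          if "weight_hom (row_weight z) e p" "e \<ge> 1" "mvar (z, k') * p \<in> ideal_generated (edge_polys F)"
          for e and p :: "('n \<times> 'd, 'k) mpoly"
          using less.hyps[OF card F, of k' UNIV z e p] that by (simp add: trunc_gens_UNIV)
        show "\<exists>b. weight_hom (row_weight z) b s" if "s \<in> edge_polys F" for s :: "('n \<times> 'd, 'k) mpoly"
          using that weight_hom_row_edge_poly unfolding edge_polys_def by blast
      qed
      \<comment> \<open>In weight \<open>s + 1\<close> of \<open>l * q\<close>, the term of
        \<open>k'\<close> carries the part of \<open>q\<close> of weight \<open>s\<close>; all other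
        terms carry the part of weight \<open>s + 1\<close>, already treated. So the weights are
        handled from the top down.\<close>
      have step: "mvar (z, m) * graded_part w s q \<in> I1"
        if next_s: "\<And>m. mvar (z, m) * graded_part w (s + 1) q \<in> I1" for s m
      proof -
        have "graded_part w (s + 1) (l * q) \<in> I1"
          using lq w_gens unfolding I1_def by (rule graded_part_ideal)
        also have "graded_part w (s + 1) (l * q)
          = (\<Sum>m\<in>UNIV. mvar (i, m) * mvar (z, m) * graded_part w (s + 1 - (if m = k' then 1 else 0)) q)"
          unfolding l_def edge_poly_def sum_distrib_right graded_part_sum
          by (intro sum.cong refl graded_part_mult_left w_xz)
        also have "\<dots> = mvar (i, k') * (mvar (z, k') * graded_part w s q)
            + (\<Sum>m\<in>UNIV - {k'}. mvar (i, m) * (mvar (z, m) * graded_part w (s + 1) q))"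
          by (subst sum.remove[of _ k']) (auto simp: mult.assoc intro!: sum.cong)
        finally have "mvar (i, k') * (mvar (z, k') * graded_part w s q)
            + (\<Sum>m\<in>UNIV - {k'}. mvar (i, m) * (mvar (z, m) * graded_part w (s + 1) q)) \<in> I1" .
        moreover have "(\<Sum>m\<in>UNIV - {k'}. mvar (i, m) * (mvar (z, m) * graded_part w (s + 1) q)) \<in> I1"
          using next_s unfolding I1_def by (intro ideal_sum) (rule ideal_mult_left, blast)
        ultimately have "mvar (i, k') * (mvar (z, k') * graded_part w s q) \<in> I1"
          unfolding I1_def using ideal_diff by fastforce
        moreover have "weight_hom (row_weight i) e (mvar (z, k') * graded_part w s q)"
        proof -
          have "weight_hom (row_weight i) 0 (mvar (z, k') :: ('n \<times> 'd, 'k) mpoly)"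
            by (rule weight_hom_mvar) (use iz in simp)
          from weight_hom_mult[OF this weight_hom_graded_part_other[OF hq]] show ?thesis by simp
        qed
        \<comment> \<open>The induction hypothesis for \<open>F\<close> and \<open>C - {k}\<close>
          cancels \<open>mvar (i, k')\<close>.\<close>
        ultimately have zs: "mvar (z, k') * graded_part w s q \<in> I1"
          using less.hyps[OF card F k' _ dim'] unfolding I1_def by blast
        \<comment> \<open>Modulo \<open>S1\<close> the relation is moved into the component of
          \<open>z\<close>, where \<open>swap\<close> applies.\<close>
        obtain r where r: "graded_part w s q - r \<in> ideal_generated S1"
          "\<And>y. y \<in> polys_in (- A) \<Longrightarrow> graded_part w s q * y \<in> ideal_generated (S1 \<union> S2) \<Longrightarrow> r * y \<in> ideal_generated S2"
          using ideal_disjoint_split[OF S1 S2] by blast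
        have "graded_part w s q * mvar (z, k') \<in> ideal_generated (S1 \<union> S2)"
          using zs unfolding I1_def S12 by (simp add: mult.commute)
        then have "r * mvar (z, k') \<in> ideal_generated S2"
          by (rule r(2)[OF zA])
        then have "mvar (z, m) * r \<in> I0"
          using S2F swap F_I0 by blast
        then have 1: "mvar (z, m) * r \<in> I1" using I01 by blast
        have "mvar (z, m) * (graded_part w s q - r) \<in> I1"
          using r(1) S1I unfolding I1_def by (intro ideal_mult_left) auto
        then show ?thesis
          using 1 unfolding I1_def right_diff_distrib using ideal_add by fastforce
      qed
      obtain M where M: "\<And>s. s > M \<Longrightarrow> graded_part w s q = 0"
        using graded_part_eventually_zero by blast
      have all: "mvar (z, m) * graded_part w s q \<in> I1" if "s > M - int n" for n s m
        using that
      proof (induction n arbitrary: s m)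
        case 0
        then show ?case using M by (simp add: I1_def)
      next
        case (Suc n)
        show ?case
          by (rule step) (rule Suc.IH, use Suc.prems in linarith)
      qed
      have all': "mvar (z, m) * graded_part w s q \<in> I1" for s m
      proof -
        have "s > M - int (nat (M - s + 1))" by linarith
        then show ?thesis by (rule all)
      qed
      have zm: "weight_hom w (w (z, m)) (mvar (z, m) :: ('n \<times> 'd, 'k) mpoly)"
        by (rule weight_hom_mvar) simp
      show ?thesis
        unfolding I1_def
        by (rule mem_ideal_if_graded_parts[where w = w], subst graded_part_mult_left[OF zm], fold I1_def) (rule all')
    qed

    \<comment> \<open>The same splitting for the whole of \<open>q\<close>. The relations on
      \<open>r\<close> come from \<open>S2\<close>, which lacks \<open>mvar (i, k)\<close>, so they
      hold in \<open>I0\<close> and not merely in \<open>I1\<close>.\<close>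
    obtain r where r: "q - r \<in> ideal_generated S1"
      "\<And>y. y \<in> polys_in (- A) \<Longrightarrow> q * y \<in> ideal_generated (S1 \<union> S2) \<Longrightarrow> r * y \<in> ideal_generated S2"
      using ideal_disjoint_split[OF S1 S2] by blast
    have zr: "mvar (z, m) * r \<in> I0" for m
    proof -
      have "q * mvar (z, m) \<in> ideal_generated (S1 \<union> S2)"
        using zq[of m] unfolding I1_def S12 by (simp add: mult.commute)
      then have "r * mvar (z, m) \<in> ideal_generated S2"
        by (rule r(2)[OF zA])
      then show ?thesis using S2F F_I0 by (auto simp: mult.commute)
    qed
    have lr: "l * r \<in> I0"
      unfolding l_def edge_poly_def sum_distrib_right I0_def mult.assoc
      by (intro ideal_sum) (rule ideal_mult_left, rule zr[unfolded I0_def])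
    \<comment> \<open>Modulo \<open>I0\<close>, \<open>q\<close> is \<open>r\<close>, which
      \<open>l\<close> annihilates, plus a multiple of \<open>mvar (i, k)\<close>. That multiple is
      absorbed by changing \<open>h\<close> by a multiple of \<open>l\<close>.\<close>
    have "q - r \<in> ideal_generated (insert (mvar (i, k)) (trunc_gens F i C))"
      using r(1) S1I k unfolding I1_def by (auto simp: trunc_gens_remove)
    then obtain q1 j1 where q1: "q - r = mvar (i, k) * q1 + j1" "j1 \<in> I0"
      unfolding I0_def by (rule ideal_insertE)
    \<comment> \<open>Row degree \<open>e - 1\<close> makes \<open>l * q2\<close> homogeneous of
      degree \<open>e\<close>, so that the induction hypothesis for \<open>F\<close> and the same
      \<open>C\<close> applies to \<open>h - l * q2\<close>.\<close>
    define q2 where "q2 = graded_part (row_weight i) (e - 1) q1"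
    have "mvar (i, k) * (h - l * q1) = l * (q - mvar (i, k) * q1) + j"
      using qj by (simp add: algebra_simps)
    also have "q - mvar (i, k) * q1 = r + j1" using q1(1) by (simp add: algebra_simps)
    finally have "mvar (i, k) * (h - l * q1) = l * r + l * j1 + j" by (simp add: distrib_left)
    then have "mvar (i, k) * (h - l * q1) \<in> I0"
      using lr q1(2) j unfolding I0_def by (auto intro!: ideal_add ideal_mult_left)
    then have "graded_part (row_weight i) (e + 1) (mvar (i, k) * (h - l * q1)) \<in> I0"
      by (rule graded_part_I0)
    then have "mvar (i, k) * (h - l * q2) \<in> I0"
      using graded_part_weight_hom[OF h, of e]
      by (simp add: graded_part_mult_left[OF hx] graded_part_diff graded_part_mult_left[OF hl] q2_def)
    moreover have "weight_hom (row_weight i) e (h - l * q2)"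
    proof -
      have "weight_hom (row_weight i) (1 + (e - 1)) (l * q2)"
        unfolding q2_def by (intro weight_hom_mult hl weight_hom_graded_part)
      then show ?thesis using h by (intro weight_hom_diff) auto
    qed
    ultimately have "h - l * q2 \<in> I0"
      using less.hyps[OF card F k, of i e "h - l * q2"] dim deg unfolding I0_def by fastforce
    moreover have "I0 \<subseteq> ideal_generated (trunc_gens E i C)"
      unfolding I0_def E_eq trunc_gens_insert by (rule ideal_mono) auto
    moreover have "l * q2 \<in> ideal_generated (trunc_gens E i C)"
      unfolding E_eq trunc_gens_insert l_def by (intro ideal_mult_right ideal_base) simp
    ultimately show ?thesis
      using ideal_add[of "h - l * q2" _ "l * q2"] by auto
  qed
qed

section \<open>Cancelling powers and products of coordinates\<close>

lemma coord_saturated: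
  fixes E :: "'n::finite set set" and h :: "('n \<times> 'd::finite, 'k::field) mpoly"
  assumes E: "acyclic_graph E" and h: "mvar (i, k) * (mvar (i, k) * h) \<in> lss_ideal E"
  shows "mvar (i, k) * h \<in> lss_ideal E"
  unfolding lss_ideal_edge_polys
proof (rule row_regular_mult)
  show "mvar (i, k) * (mvar (i, k) * h) \<in> ideal_generated (edge_polys E)"
    using h by (simp add: lss_ideal_edge_polys)
  show "p \<in> ideal_generated (edge_polys E)"
    if "weight_hom (row_weight i) e p" "e \<ge> 1" "mvar (i, k) * p \<in> ideal_generated (edge_polys E)"
    for e and p :: "('n \<times> 'd, 'k) mpoly"
    using row_regular[OF E, of k UNIV i e p] that by (simp add: trunc_gens_UNIV)
  show "\<exists>b. weight_hom (row_weight i) b s" if "s \<in> edge_polys E" for s :: "('n \<times> 'd, 'k) mpoly"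
    using that weight_hom_row_edge_poly unfolding edge_polys_def by blast
qed

text \<open>Below degree \<open>CARD('d)\<close> the second alternative in
  \<open>row_regular\<close> holds with \<open>C = UNIV\<close>, so components of every row degree
  can be cancelled, including degree 0.\<close>

lemma coord_regular:
  fixes E :: "'n::finite set set" and h :: "('n \<times> 'd::finite, 'k::field) mpoly"
  assumes E: "acyclic_graph E" and deg: "vertex_degree E i < CARD('d)" and h: "mvar (i, k) * h \<in> lss_ideal E"
  shows "h \<in> lss_ideal E"
  unfolding lss_ideal_edge_polys
proof (rule mem_ideal_if_graded_parts)
  fix a
  have hx: "weight_hom (row_weight i) 1 (mvar (i, k) :: ('n \<times> 'd, 'k) mpoly)"
    by (rule weight_hom_mvar) simp
  have "graded_part (row_weight i) (a + 1) (mvar (i, k) * h) \<in> ideal_generated (edge_polys E)"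
    using h unfolding lss_ideal_edge_polys
    by (rule graded_part_ideal) (use weight_hom_row_edge_poly in \<open>unfold edge_polys_def, blast\<close>)
  then have "mvar (i, k) * graded_part (row_weight i) a h \<in> ideal_generated (edge_polys E)"
    by (simp add: graded_part_mult_left[OF hx])
  then show "graded_part (row_weight i) a h \<in> ideal_generated (edge_polys E)"
    using row_regular[OF E, of k UNIV i a "graded_part (row_weight i) a h"] deg
      weight_hom_graded_part[of "row_weight i" a h]
    by (simp add: trunc_gens_UNIV)
qed

lemma coord_power_saturated:
  fixes E :: "'n::finite set set" and h :: "('n \<times> 'd::finite, 'k::field) mpoly"
  assumes E: "acyclic_graph E"
  shows "mvar (i, k) ^ N * h \<in> lss_ideal E \<Longrightarrow> mvar (i, k) * h \<in> lss_ideal E"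
proof (induction N)
  case 0
  then show ?case by (simp add: lss_ideal_def ideal_mult_left)
next
  case (Suc N)
  show ?case
  proof (cases N)
    case 0
    then show ?thesis using Suc.prems by simp
  next
    case (Suc M)
    then have "mvar (i, k) * (mvar (i, k) * (mvar (i, k) ^ M * h)) \<in> lss_ideal E"
      using Suc.prems by (simp add: mult.assoc)
    then have "mvar (i, k) * (mvar (i, k) ^ M * h) \<in> lss_ideal E"
      by (rule coord_saturated[OF E])
    then show ?thesis using Suc Suc.IH by (simp add: mult.assoc)
  qed
qed

text \<open>Vertex by vertex, the power of the coordinate drops to exponent 1 by saturation, and to
  0 by regularity if the vertex is not heavy. Factors not yet or already treated are carried along
  in \<open>h\<close>.\<close>

lemma coord_prod_saturated:
  fixes E :: "'n::finite set set" and h :: "('n \<times> 'd::finite, 'k::field) mpoly"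
  assumes E: "acyclic_graph E"
  shows "(\<Prod>i\<in>S. mvar (i, k)) ^ N * h \<in> lss_ideal E
    \<Longrightarrow> (\<Prod>i\<in>{i\<in>S. vertex_degree E i \<ge> CARD('d)}. mvar (i, k)) * h \<in> lss_ideal E"
proof (induction S arbitrary: h rule: infinite_finite_induct)
  case (infinite A)
  then show ?case by simp
next
  case empty
  then show ?case by simp
next
  case (insert j S)
  let ?H = "{i\<in>S. vertex_degree E i \<ge> CARD('d)}"
  have "mvar (j, k) ^ N * ((\<Prod>i\<in>S. mvar (i, k)) ^ N * h) \<in> lss_ideal E"
    using insert.prems insert.hyps by (simp add: power_mult_distrib mult.assoc)
  then have 1: "mvar (j, k) * ((\<Prod>i\<in>S. mvar (i, k)) ^ N * h) \<in> lss_ideal E"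
    by (rule coord_power_saturated[OF E])
  show ?case
  proof (cases "vertex_degree E j \<ge> CARD('d)")
    case True
    then have eq: "{i\<in>insert j S. vertex_degree E i \<ge> CARD('d)} = insert j ?H" by auto
    have "(\<Prod>i\<in>?H. mvar (i, k)) * (mvar (j, k) * h) \<in> lss_ideal E"
      using 1 by (intro insert.IH) (simp add: mult.left_commute)
    then show ?thesis
      using insert.hyps unfolding eq by (simp add: mult.left_commute mult.assoc)
  next
    case False
    then have eq: "{i\<in>insert j S. vertex_degree E i \<ge> CARD('d)} = ?H" by auto
    have "(\<Prod>i\<in>S. mvar (i, k)) ^ N * h \<in> lss_ideal E"
      by (rule coord_regular[OF E _ 1]) (use False in simp)
    then show ?thesis unfolding eq by (rule insert.IH)
  qed
qed


section \<open>Evaluation\<close>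

lemma mpoly_eval_superset:
  assumes "finite F" "Poly_Mapping.keys f \<subseteq> F"
  shows "mpoly_eval a f = (\<Sum>m\<in>F. Poly_Mapping.lookup f m *
    (\<Prod>x\<in>Poly_Mapping.keys m. a x ^ Poly_Mapping.lookup m x))"
  unfolding mpoly_eval_def
  by (rule sum.mono_neutral_left) (use assms in \<open>auto simp: in_keys_iff\<close>)

lemma mpoly_eval_add: "mpoly_eval a (f + g) = mpoly_eval a f + mpoly_eval a g"
proof -
  let ?F = "Poly_Mapping.keys f \<union> Poly_Mapping.keys g"
  have "Poly_Mapping.keys (f + g) \<subseteq> ?F" by (rule keys_add)
  then show ?thesis
    by (simp add: mpoly_eval_superset[where F = ?F] lookup_add distrib_right sum.distrib)
qed

lemma mpoly_eval_zero [simp]: "mpoly_eval a 0 = 0"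
  by (simp add: mpoly_eval_def)

lemma mpoly_eval_uminus: "mpoly_eval a (- f) = - mpoly_eval a f"
  using mpoly_eval_add[of a f "- f"] by (simp add: eq_neg_iff_add_eq_0 add.commute)

lemma mpoly_eval_diff: "mpoly_eval a (f - g) = mpoly_eval a f - mpoly_eval a g"
  using mpoly_eval_add[of a f "- g"] by (simp add: mpoly_eval_uminus)

lemma mpoly_eval_sum: "mpoly_eval a (sum f A) = (\<Sum>i\<in>A. mpoly_eval a (f i))"
  by (induction A rule: infinite_finite_induct) (auto simp: mpoly_eval_add)

lemma mpoly_eval_single:
  fixes a :: "'x::finite \<Rightarrow> 'k::comm_ring_1"
  shows "mpoly_eval a (Poly_Mapping.single m c) = c * (\<Prod>x\<in>UNIV. a x ^ Poly_Mapping.lookup m x)"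
proof -
  have "(\<Prod>x\<in>Poly_Mapping.keys m. a x ^ Poly_Mapping.lookup m x) = (\<Prod>x\<in>UNIV. a x ^ Poly_Mapping.lookup m x)"
    by (rule prod.mono_neutral_left) (auto simp: in_keys_iff)
  then show ?thesis
    by (subst mpoly_eval_superset[of "{m}"]) auto
qed

lemma mpoly_eval_mult:
  fixes a :: "'x::finite \<Rightarrow> 'k::comm_ring_1"
  shows "mpoly_eval a (f * g) = mpoly_eval a f * mpoly_eval a g"
proof (induction f rule: poly_mapping_induct_add)
  case (single m c)
  show ?case
  proof (induction g rule: poly_mapping_induct_add)
    case (single n b)
    then show ?case
      by (simp add: mult_single mpoly_eval_single lookup_add power_add prod.distrib algebra_simps)
  next
    case (add p q)
    then show ?case by (simp add: distrib_left mpoly_eval_add)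
  qed
next
  case (add p q)
  then show ?case by (simp add: distrib_right mpoly_eval_add)
qed

lemma mpoly_eval_one [simp]:
  fixes a :: "'x::finite \<Rightarrow> 'k::comm_ring_1"
  shows "mpoly_eval a 1 = 1"
  using mpoly_eval_single[of a 0 1] by simp

lemma mpoly_eval_mvar [simp]:
  fixes a :: "'x::finite \<Rightarrow> 'k::comm_ring_1"
  shows "mpoly_eval a (mvar x) = a x"
proof -
  have "(\<Prod>y\<in>UNIV. a y ^ Poly_Mapping.lookup (Poly_Mapping.single x 1) y) = (\<Prod>y\<in>UNIV. if y = x then a y else 1)"
    by (rule prod.cong) (auto simp: lookup_single when_def)
  then show ?thesis by (simp add: mvar_def mpoly_eval_single)
qed

lemma mpoly_eval_prod:
  fixes a :: "'x::finite \<Rightarrow> 'k::comm_ring_1"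
  shows "mpoly_eval a (prod f A) = (\<Prod>i\<in>A. mpoly_eval a (f i))"
  by (induction A rule: infinite_finite_induct) (auto simp: mpoly_eval_mult)

lemma mpoly_eval_det:
  fixes a :: "'x::finite \<Rightarrow> 'k::comm_ring_1" and M :: "('x, 'k) mpoly ^ 'd ^ 'd"
  shows "mpoly_eval a (det M) = det (\<chi> i j. mpoly_eval a (M $ i $ j))"
proof -
  have "mpoly_eval a (of_int (sign p)) = (of_int (sign p) :: 'k)" for p :: "'d \<Rightarrow> 'd"
    by (auto simp: sign_def mpoly_eval_uminus)
  then show ?thesis
    by (simp add: det_def mpoly_eval_sum mpoly_eval_mult mpoly_eval_prod)
qed

lemma mpoly_eval_cong:
  assumes "f \<in> polys_in A" "\<And>x. x \<in> A \<Longrightarrow> a x = b x"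
  shows "mpoly_eval a f = mpoly_eval b f"
  unfolding mpoly_eval_def
proof (intro sum.cong refl arg_cong2[of _ _ _ _ "(*)"] prod.cong)
  fix m x assume "m \<in> Poly_Mapping.keys f" "x \<in> Poly_Mapping.keys m"
  then have "x \<in> A" using assms(1) by (auto simp: polys_in_def)
  then show "a x ^ Poly_Mapping.lookup m x = b x ^ Poly_Mapping.lookup m x"
    using assms(2) by simp
qed

lemma mpoly_eval_ideal:
  fixes a :: "'x::finite \<Rightarrow> 'k::comm_ring_1"
  assumes "f \<in> ideal_generated S" "\<And>s. s \<in> S \<Longrightarrow> mpoly_eval a s = 0"
  shows "mpoly_eval a f = 0"
  using assms(1) unfolding ideal_generated_def
  by (induction rule: ideal_module.span_induct_alt) (auto simp: mpoly_eval_add mpoly_eval_mult assms(2))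

section \<open>Polynomial functions on curves and over infinite fields\<close>

lemma mpoly_eval_along_polys:
  fixes a :: "'x \<Rightarrow> 'k::comm_ring_1 poly"
  obtains P where "\<And>s. poly P s = mpoly_eval (\<lambda>x. poly (a x) s) f"
proof
  show "poly (\<Sum>m\<in>Poly_Mapping.keys f. [:Poly_Mapping.lookup f m:] *
     (\<Prod>x\<in>Poly_Mapping.keys m. a x ^ Poly_Mapping.lookup m x)) s = mpoly_eval (\<lambda>x. poly (a x) s) f" for s
    by (simp add: mpoly_eval_def poly_sum poly_prod poly_mult)
qed

lemma infinite_UNIV_alg_closed_field: "infinite (UNIV :: 'k::alg_closed_field set)"
proof
  assume fin: "finite (UNIV :: 'k set)"
  let ?p = "\<Prod>a\<in>UNIV. [:- a, 1:] :: 'k poly"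
  have "degree ?p = card (UNIV :: 'k set)"
    by (subst degree_prod_eq_sum_degree) auto
  then have "degree ?p > 0" using fin by (simp add: card_gt_0_iff)
  then have "degree (?p + 1) > 0" by (simp add: degree_add_eq_left)
  then obtain x where "poly (?p + 1) x = 0"
    using alg_closed_imp_poly_has_root by blast
  moreover have "poly ?p x = 0"
    using fin by (auto simp: poly_prod)
  ultimately show False by simp
qed

text \<open>Each monomial of weight \<open>t\<close> picks up the factor \<open>s ^ t\<close>. The
  weights are natural numbers, so that the powers make sense without inverses.\<close>

lemma mpoly_eval_scale:
  fixes a :: "'x::finite \<Rightarrow> 'k::comm_ring_1"
  assumes "weight_hom (\<lambda>x. int (w x)) (int t) f"
  shows "mpoly_eval (\<lambda>x. s ^ w x * a x) f = s ^ t * mpoly_eval a f"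
proof -
  have mono: "mpoly_eval (\<lambda>x. s ^ w x * a x) (Poly_Mapping.single m c)
      = s ^ t * mpoly_eval a (Poly_Mapping.single m c)"
    if "m \<in> Poly_Mapping.keys f" for m c
  proof -
    have "int (\<Sum>x\<in>UNIV. w x * Poly_Mapping.lookup m x) = int t"
      using assms that by (simp add: weight_hom_def weight_degree_def mult.commute)
    then have t: "(\<Sum>x\<in>UNIV. w x * Poly_Mapping.lookup m x) = t" by (simp only: of_nat_eq_iff)
    show ?thesis
      unfolding t[symmetric]
      by (simp add: mpoly_eval_single power_mult_distrib prod.distrib power_sum mult.left_commute
          flip: power_mult)
  qed
  show ?thesis
    by (induction f rule: poly_mapping_keys_induct) (auto simp: mono mpoly_eval_add distrib_left)
qed

text \<open>As a function of the scaling parameter, the value of \<open>f\<close> is a univariate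
  polynomial whose coefficients are the values of the graded parts; infinitely many roots kill all
  of them.\<close>

lemma mpoly_eval_graded_part_eq_zero:
  fixes a :: "'x::finite \<Rightarrow> 'k::field"
  assumes inf: "infinite X" and van: "\<And>s. s \<in> X \<Longrightarrow> mpoly_eval (\<lambda>x. s ^ w x * a x) f = 0"
  shows "mpoly_eval a (graded_part (\<lambda>x. int (w x)) (int t) f) = 0"
proof -
  let ?w = "\<lambda>x. int (w x)"
  obtain M where M: "\<And>s. s > M \<Longrightarrow> graded_part ?w s f = 0"
    using graded_part_eventually_zero by blast
  \<comment> \<open>The range covers every nonzero part of \<open>f\<close> and also the index
    \<open>t\<close>, whose coefficient is read off at the end.\<close>
  define B where "B = max t (nat M)"
  have f: "f = (\<Sum>t\<le>B. graded_part ?w (int t) f)"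
  proof (rule poly_mapping_eqI)
    fix m
    have deg: "weight_degree ?w m \<ge> 0" unfolding weight_degree_def by (intro sum_nonneg) auto
    have "Poly_Mapping.lookup (\<Sum>t\<le>B. graded_part ?w (int t) f) m
        = (\<Sum>t\<le>B. if t = nat (weight_degree ?w m) then Poly_Mapping.lookup f m else 0)"
      unfolding lookup_sum lookup_graded_part by (rule sum.cong) (use deg in auto)
    also have "\<dots> = Poly_Mapping.lookup f m"
    proof (cases "nat (weight_degree ?w m) \<le> B")
      case False
      then have "weight_degree ?w m > M" unfolding B_def by linarith
      from M[OF this] have "Poly_Mapping.lookup f m = 0"
        using lookup_graded_part[of ?w "weight_degree ?w m" f m] by simp
      then show ?thesis by simp
    qed simp
    finally show "Poly_Mapping.lookup f m = Poly_Mapping.lookup (\<Sum>t\<le>B. graded_part ?w (int t) f) m" by simp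
  qed
  define P where "P = (\<Sum>t\<le>B. monom (mpoly_eval a (graded_part ?w (int t) f)) t)"
  have "poly P s = mpoly_eval (\<lambda>x. s ^ w x * a x) f" for s
  proof -
    have "mpoly_eval (\<lambda>x. s ^ w x * a x) (graded_part ?w (int t) f)
        = mpoly_eval a (graded_part ?w (int t) f) * s ^ t" for t
      by (subst mpoly_eval_scale[OF weight_hom_graded_part]) (rule mult.commute)
    then show ?thesis
      by (subst f) (simp add: P_def poly_sum poly_monom mpoly_eval_sum)
  qed
  then have "X \<subseteq> {s. poly P s = 0}" using van by auto
  then have "P = 0" using inf poly_roots_finite finite_subset by blast
  then have "coeff P t = 0" by simp
  moreover have "coeff P t = mpoly_eval a (graded_part ?w (int t) f)"
    by (simp add: P_def coeff_sum B_def)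
  ultimately show ?thesis by simp
qed

text \<open>Two distinct monomials differ in the exponent of some variable. The part with the
  exponent of the first still vanishes everywhere but has fewer monomials; a single monomial is
  tested at the all-ones point.\<close>

lemma mpoly_vanishing_eq_zero:
  fixes f :: "('x::finite, 'k::field) mpoly"
  assumes inf: "infinite (UNIV :: 'k set)" and "\<And>a. mpoly_eval a f = 0"
  shows "f = 0"
  using assms(2)
proof (induction "card (Poly_Mapping.keys f)" arbitrary: f rule: less_induct)
  case less
  show ?case
  proof (rule ccontr)
    assume "f \<noteq> 0"
    then obtain m where m: "m \<in> Poly_Mapping.keys f"
      by (metis in_keys_iff lookup_zero poly_mapping_eqI)
    show False
    proof (cases "Poly_Mapping.keys f = {m}")
      case True
      then have "f = Poly_Mapping.single m (Poly_Mapping.lookup f m)"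
        using poly_mapping_sum_single[of f] by simp
      then have "Poly_Mapping.lookup f m = 0"
        using less.prems[of "\<lambda>_. 1"] mpoly_eval_single[of "\<lambda>_. 1" m "Poly_Mapping.lookup f m"] by simp
      then show False using m by (simp add: in_keys_iff)
    next
      case False
      then obtain n where n: "n \<in> Poly_Mapping.keys f" "n \<noteq> m" using m by blast
      then obtain x where x: "Poly_Mapping.lookup n x \<noteq> Poly_Mapping.lookup m x"
        by (metis poly_mapping_eqI)
      define w :: "'x \<Rightarrow> nat" where "w = (\<lambda>y. if y = x then 1 else 0)"
      have w: "weight_degree (\<lambda>y. int (w y)) k = int (Poly_Mapping.lookup k x)" for k
      proof -
        have "weight_degree (\<lambda>y. int (w y)) k = (\<Sum>y\<in>UNIV. if y = x then int (Poly_Mapping.lookup k y) else 0)"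
          unfolding weight_degree_def by (rule sum.cong) (auto simp: w_def)
        then show ?thesis by simp
      qed
      define g where "g = graded_part (\<lambda>y. int (w y)) (int (Poly_Mapping.lookup m x)) f"
      have "Poly_Mapping.keys g \<subseteq> Poly_Mapping.keys f - {n}"
        using x by (auto simp: g_def in_keys_iff lookup_graded_part w split: if_splits)
      then have "card (Poly_Mapping.keys g) < card (Poly_Mapping.keys f)"
        using n(1) by (intro psubset_card_mono) auto
      moreover have "mpoly_eval a g = 0" for a
        unfolding g_def by (rule mpoly_eval_graded_part_eq_zero[OF inf]) (rule less.prems)
      ultimately have "g = 0" by (rule less.hyps)
      moreover have "Poly_Mapping.lookup g m = Poly_Mapping.lookup f m"
        by (simp add: g_def lookup_graded_part w)
      ultimately show False using m by (simp add: in_keys_iff)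
    qed
  qed
qed

section \<open>Points with nonzero vectors\<close>

abbreviation coords :: "'k ^ 'd ^ 'n \<Rightarrow> 'n \<times> 'd \<Rightarrow> 'k" where
  "coords v \<equiv> \<lambda>(i, k). v $ i $ k"

lemma mpoly_eval_edge_poly:
  fixes v :: "'k::comm_ring_1 ^ 'd::finite ^ 'n::finite"
  shows "mpoly_eval (coords v) (edge_poly i j) = dot (v $ i) (v $ j)"
  by (simp add: edge_poly_def dot_def mpoly_eval_sum mpoly_eval_mult)

lemma mpoly_eval_lss_ideal:
  fixes v :: "'k::comm_ring_1 ^ 'd::finite ^ 'n::finite"
  assumes "f \<in> lss_ideal E" "v \<in> orth_reps E"
  shows "mpoly_eval (coords v) f = 0"
  using assms(1) unfolding lss_ideal_edge_polys
  by (rule mpoly_eval_ideal)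
    (use assms(2) in \<open>auto simp: edge_polys_def mpoly_eval_edge_poly orth_reps_def\<close>)

lemma p_empty_iff: "f \<in> p_empty E \<longleftrightarrow> (\<forall>v\<in>nonzero_orth_reps E. mpoly_eval (coords v) f = 0)"
  by (simp add: p_empty_def vanishing_ideal_def)

lemma nonzero_orth_reps_antimono: "E \<subseteq> F \<Longrightarrow> nonzero_orth_reps F \<subseteq> nonzero_orth_reps E"
  unfolding nonzero_orth_reps_def orth_reps_def by blast

lemma p_empty_mono: "E \<subseteq> F \<Longrightarrow> p_empty E \<subseteq> p_empty F"
  by (intro subsetI) (simp add: p_empty_iff subsetD[OF nonzero_orth_reps_antimono])

lemma lss_ideal_mono: "E \<subseteq> F \<Longrightarrow> lss_ideal E \<subseteq> lss_ideal F"
  unfolding lss_ideal_edge_polys by (intro ideal_mono edge_polys_mono)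

lemma lss_ideal_subset_p_empty: "lss_ideal E \<subseteq> p_empty E"
  by (auto simp: p_empty_iff nonzero_orth_reps_def intro: mpoly_eval_lss_ideal)

lemma p_empty_add: "f \<in> p_empty E \<Longrightarrow> g \<in> p_empty E \<Longrightarrow> f + g \<in> p_empty E"
  by (simp add: p_empty_iff mpoly_eval_add)

lemma p_empty_diff: "f \<in> p_empty E \<Longrightarrow> g \<in> p_empty E \<Longrightarrow> f - g \<in> p_empty E"
  by (simp add: p_empty_iff mpoly_eval_diff)

lemma p_empty_mult_left:
  fixes f :: "('n::finite \<times> 'd::finite, 'k::comm_ring_1) mpoly"
  shows "f \<in> p_empty E \<Longrightarrow> g * f \<in> p_empty E"
  by (simp add: p_empty_iff mpoly_eval_mult)

section \<open>Orthogonal vectors and the connecting curves\<close>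

lemma dot_commute: "dot x y = dot y x"
  by (simp add: dot_def mult.commute)

lemma dot_sum_remove:
  fixes x :: "'k::comm_ring_1 ^ 'd::finite"
  shows "dot x y = x $ k * y $ k + (\<Sum>l\<in>UNIV - {k}. x $ l * y $ l)"
  unfolding dot_def by (rule sum.remove) auto

lemma orthogonal_nonzero_exists:
  fixes x :: "'k::field ^ 'd::finite"
  assumes "CARD('d) \<ge> 2"
  shows "\<exists>y. y \<noteq> 0 \<and> dot x y = 0"
proof -
  obtain k l :: 'd where kl: "k \<noteq> l"
    using assms by (metis card_2_iff' card_le_Suc0_iff_eq finite_code not_less_eq_eq numeral_2_eq_2 UNIV_I)
  have dot: "dot x (\<chi> m. if m = k then a else if m = l then b else 0) = x $ k * a + x $ l * b" for a b
  proof -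
    have "dot x (\<chi> m. if m = k then a else if m = l then b else 0)
      = (\<Sum>m\<in>UNIV. (if m = k then x $ k * a else 0) + (if m = l then x $ l * b else 0))"
      unfolding dot_def by (rule sum.cong) (use kl in auto)
    then show ?thesis by (simp add: sum.distrib)
  qed
  show ?thesis
  proof (cases "x $ k = 0 \<and> x $ l = 0")
    case True
    show ?thesis
      by (rule exI[of _ "\<chi> m. if m = k then 1 else if m = l then 0 else 0"])
        (use True in \<open>auto simp: dot vec_eq_iff\<close>)
  next
    case False
    show ?thesis
      by (rule exI[of _ "\<chi> m. if m = k then x $ l else if m = l then - x $ k else 0"])
        (use False kl in \<open>auto simp: dot vec_eq_iff\<close>)
  qed
qed

lemma dot_one_exists:
  fixes x :: "'k::field ^ 'd::finite"
  assumes "x \<noteq> 0"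
  shows "\<exists>y. dot y x = 1"
proof -
  obtain k where k: "x $ k \<noteq> 0" using assms by (auto simp: vec_eq_iff)
  have "dot (\<chi> m. if m = k then inverse (x $ k) else 0) x = (\<Sum>m\<in>UNIV. if m = k then 1 else 0)"
    unfolding dot_def by (rule sum.cong) (use k in auto)
  then show ?thesis by auto
qed

text \<open>
  If \<open>dot y x = 1\<close> and \<open>dot u x = 0\<close>, then \<open>u = A x\<close> for the alternating matrix
  \<open>A = u y\<^sup>T - y u\<^sup>T\<close>, and \<open>A x'\<close> is orthogonal to \<open>x'\<close> for every \<open>x'\<close>.  So the vector of a leaf
  follows any path of the vector of its neighbour.
\<close>

lemma nonzero_orth_reps_path:
  fixes v w :: "'k::field ^ 'd::finite ^ 'n::finite"
  assumes "acyclic_graph E" "v \<in> nonzero_orth_reps E" "w \<in> nonzero_orth_reps E"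
  shows "\<exists>\<gamma> :: 'n \<Rightarrow> 'd \<Rightarrow> 'k poly. (\<forall>i k. poly (\<gamma> i k) 0 = v $ i $ k \<and> poly (\<gamma> i k) 1 = w $ i $ k)
    \<and> (\<forall>i j. {i, j} \<in> E \<longrightarrow> (\<Sum>k\<in>UNIV. \<gamma> i k * \<gamma> j k) = 0)"
  using assms
proof (induction E rule: acyclic_graph_leaf_induct)
  case empty
  show ?case
    by (rule exI[of _ "\<lambda>i k. [:v $ i $ k, w $ i $ k - v $ i $ k:]"]) simp
next
  case (leaf E p c)
  have "v \<in> nonzero_orth_reps E" "w \<in> nonzero_orth_reps E"
    using leaf.prems nonzero_orth_reps_antimono[of E "insert {p, c} E"] by blast+
  then obtain \<gamma> :: "'n \<Rightarrow> 'd \<Rightarrow> 'k poly" where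
    \<gamma>: "\<And>i k. poly (\<gamma> i k) 0 = v $ i $ k" "\<And>i k. poly (\<gamma> i k) 1 = w $ i $ k"
      "\<And>i j. {i, j} \<in> E \<Longrightarrow> (\<Sum>k\<in>UNIV. \<gamma> i k * \<gamma> j k) = 0"
    using leaf.IH by blast
  have orth: "dot (v $ c) (v $ p) = 0" "dot (w $ c) (w $ p) = 0"
    using leaf.prems by (auto simp: nonzero_orth_reps_def orth_reps_def insert_commute)
  obtain y0 y1 where y: "dot y0 (v $ p) = 1" "dot y1 (w $ p) = 1"
    using leaf.prems dot_one_exists unfolding nonzero_orth_reps_def by blast
  \<comment> \<open>\<delta> pairs a vector with the moving vector of \<open>p\<close>, and \<eta>
    is \<open>t\<close> times the alternating matrix of \<open>u\<close> and \<open>y\<close>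
    applied to that vector.\<close>
  define \<delta> :: "'k ^ 'd \<Rightarrow> 'k poly" where "\<delta> u = (\<Sum>l\<in>UNIV. [:u $ l:] * \<gamma> p l)" for u
  define \<eta> :: "'k poly \<Rightarrow> 'k ^ 'd \<Rightarrow> 'k ^ 'd \<Rightarrow> 'd \<Rightarrow> 'k poly" where
    "\<eta> t u y k = t * ([:u $ k:] * \<delta> y - [:y $ k:] * \<delta> u)" for t u y k
  \<comment> \<open>The factors \<open>1 - s\<close> and \<open>s\<close> switch from the
    alternating matrix that sends \<open>v $ p\<close> to \<open>v $ c\<close> at parameter 0 to the
    one that sends \<open>w $ p\<close> to \<open>w $ c\<close> at parameter 1.\<close>
  define \<gamma>' where "\<gamma>' i k = (if i = c
    then \<eta> [:1, - 1:] (v $ c) y0 k + \<eta> [:0, 1:] (w $ c) y1 k else \<gamma> i k)" for i k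
  have \<delta>: "poly (\<delta> u) 0 = dot u (v $ p)" "poly (\<delta> u) 1 = dot u (w $ p)" for u
    by (simp_all add: \<delta>_def dot_def poly_sum \<gamma>)
  have \<eta>: "(\<Sum>k\<in>UNIV. \<gamma> p k * \<eta> t u y k) = 0" for t u y
  proof -
    have "(\<Sum>k\<in>UNIV. \<gamma> p k * \<eta> t u y k)
        = (\<Sum>k\<in>UNIV. t * \<delta> y * ([:u $ k:] * \<gamma> p k) - t * \<delta> u * ([:y $ k:] * \<gamma> p k))"
      unfolding \<eta>_def by (rule sum.cong) (simp_all add: algebra_simps)
    also have "\<dots> = t * \<delta> y * \<delta> u - t * \<delta> u * \<delta> y"
      by (simp only: sum_subtractf flip: sum_distrib_left \<delta>_def)
    finally show ?thesis by simp
  qed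
  have pc: "(\<Sum>k\<in>UNIV. \<gamma>' p k * \<gamma>' c k) = 0"
    using \<open>p \<noteq> c\<close> by (simp add: \<gamma>'_def distrib_left sum.distrib \<eta>)
  show ?case
  proof (intro exI[of _ \<gamma>'] conjI allI impI)
    fix i k
    show "poly (\<gamma>' i k) 0 = v $ i $ k"
      by (simp add: \<gamma>'_def \<eta>_def \<delta> orth y \<gamma>)
    show "poly (\<gamma>' i k) 1 = w $ i $ k"
      by (simp add: \<gamma>'_def \<eta>_def \<delta> orth y \<gamma>)
  next
    fix i j assume ij: "{i, j} \<in> insert {p, c} E"
    show "(\<Sum>k\<in>UNIV. \<gamma>' i k * \<gamma>' j k) = 0"
    proof (cases "{i, j} = {p, c}")
      case True
      then have "i = p \<and> j = c \<or> i = c \<and> j = p" by (auto simp: doubleton_eq_iff)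
      then show ?thesis using pc by (auto simp: mult.commute)
    next
      case False
      then have "{i, j} \<in> E" using ij by blast
      moreover from this have "i \<noteq> c" "j \<noteq> c" using leaf.hyps by blast+
      ultimately show ?thesis using \<gamma>(3) by (simp add: \<gamma>'_def)
    qed
  qed
qed

text \<open>A polynomial curve joins a point where \<open>f\<close> is nonzero to one where
  \<open>g\<close> is nonzero. Both restrict to nonzero univariate polynomials, so at some parameter
  both are nonzero and no vector vanishes.\<close>

lemma p_empty_prime:
  fixes f g :: "('n::finite \<times> 'd::finite, 'k::alg_closed_field) mpoly"
  assumes E: "acyclic_graph E" and f: "f \<notin> p_empty E" and g: "g \<notin> p_empty E"
  shows "f * g \<notin> p_empty E"
proof -
  obtain v where v: "v \<in> nonzero_orth_reps E" "mpoly_eval (coords v) f \<noteq> 0"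
    using f by (auto simp: p_empty_iff)
  obtain w where w: "w \<in> nonzero_orth_reps E" "mpoly_eval (coords w) g \<noteq> 0"
    using g by (auto simp: p_empty_iff)
  obtain \<gamma> :: "'n \<Rightarrow> 'd \<Rightarrow> 'k poly" where
    \<gamma>: "\<And>i k. poly (\<gamma> i k) 0 = v $ i $ k" "\<And>i k. poly (\<gamma> i k) 1 = w $ i $ k"
      "\<And>i j. {i, j} \<in> E \<Longrightarrow> (\<Sum>k\<in>UNIV. \<gamma> i k * \<gamma> j k) = 0"
    using nonzero_orth_reps_path[OF E v(1) w(1)] by blast
  define u :: "'k \<Rightarrow> 'k ^ 'd ^ 'n" where "u s = (\<chi> i k. poly (\<gamma> i k) s)" for s
  have u: "(\<lambda>x. poly (case x of (i, k) \<Rightarrow> \<gamma> i k) s) = coords (u s)" for s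
    by (auto simp: u_def fun_eq_iff)
  have u01: "u 0 = v" "u 1 = w" by (simp_all add: u_def \<gamma> vec_eq_iff)
  obtain P where P: "\<And>s. poly P s = mpoly_eval (coords (u s)) f"
    using mpoly_eval_along_polys[of "\<lambda>(i, k). \<gamma> i k" f] unfolding u by blast
  obtain Q where Q: "\<And>s. poly Q s = mpoly_eval (coords (u s)) g"
    using mpoly_eval_along_polys[of "\<lambda>(i, k). \<gamma> i k" g] unfolding u by blast
  \<comment> \<open>A nonzero coordinate of each starting vector stays nonzero along the curve
    outside finitely many parameters; this keeps the curve generically inside
    \<open>nonzero_orth_reps E\<close>.\<close>
  have "\<exists>k. v $ i $ k \<noteq> 0" for i
    using v(1) by (auto simp: nonzero_orth_reps_def vec_eq_iff)
  then obtain \<kappa> where \<kappa>: "\<And>i. v $ i $ \<kappa> i \<noteq> 0" by metis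
  have "P \<noteq> 0" using P[of 0] v(2) u01 by auto
  moreover have "Q \<noteq> 0" using Q[of 1] w(2) u01 by auto
  moreover have "\<gamma> i (\<kappa> i) \<noteq> 0" for i using \<gamma>(1)[of i "\<kappa> i"] \<kappa>[of i] by auto
  ultimately have "P * Q * (\<Prod>i\<in>UNIV. \<gamma> i (\<kappa> i)) \<noteq> 0" by simp
  then have "finite {s. poly (P * Q * (\<Prod>i\<in>UNIV. \<gamma> i (\<kappa> i))) s = 0}"
    by (rule poly_roots_finite)
  then obtain s where s: "poly (P * Q * (\<Prod>i\<in>UNIV. \<gamma> i (\<kappa> i))) s \<noteq> 0"
    using infinite_UNIV_alg_closed_field ex_new_if_finite by blast
  have "poly (\<gamma> i (\<kappa> i)) s \<noteq> 0" for i using s by (auto simp: poly_prod)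
  then have "u s $ i \<noteq> 0" for i by (auto simp: u_def vec_eq_iff)
  moreover have "dot (u s $ i) (u s $ j) = 0" if "{i, j} \<in> E" for i j
  proof -
    have "dot (u s $ i) (u s $ j) = poly (\<Sum>k\<in>UNIV. \<gamma> i k * \<gamma> j k) s"
      by (simp add: dot_def u_def poly_sum)
    then show ?thesis using \<gamma>(3)[OF that] by simp
  qed
  ultimately have "u s \<in> nonzero_orth_reps E"
    by (simp add: nonzero_orth_reps_def orth_reps_def)
  moreover have "mpoly_eval (coords (u s)) (f * g) \<noteq> 0"
    using s P[of s] Q[of s] by (auto simp: mpoly_eval_mult)
  ultimately show ?thesis by (auto simp: p_empty_iff)
qed

text \<open>Different components do not constrain each other. In the induction an unprescribed leaf
  takes any nonzero vector orthogonal to its neighbour's, and a prescribed leaf passes its condition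
  on to the neighbour.\<close>

lemma nonzero_orth_reps_extend:
  fixes a :: "'n::finite \<Rightarrow> 'k::field ^ 'd::finite"
  assumes "acyclic_graph E" "CARD('d) \<ge> 2"
    and "\<And>s t. s \<in> S \<Longrightarrow> t \<in> S \<Longrightarrow> s \<noteq> t \<Longrightarrow> (s, t) \<notin> (adj E)\<^sup>*"
    and "\<And>s. s \<in> S \<Longrightarrow> a s \<noteq> 0"
  shows "\<exists>v\<in>nonzero_orth_reps E. \<forall>s\<in>S. v $ s = a s"
  using assms(1,3,4)
proof (induction E arbitrary: S a rule: acyclic_graph_leaf_induct)
  case empty
  have one: "(\<chi> k. 1 :: 'k ^ 'd) \<noteq> 0" by (simp add: vec_eq_iff)
  show ?case
    by (rule bexI[of _ "\<chi> i. if i \<in> S then a i else (\<chi> k. 1)"])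
      (use empty one in \<open>auto simp: nonzero_orth_reps_def orth_reps_def\<close>)
next
  case (leaf E p c)
  let ?F = "insert {p, c} E"
  have sub: "(adj E)\<^sup>* \<subseteq> (adj ?F)\<^sup>*" by (rule adj_mono) auto
  have set_c: "(\<chi> i. if i = c then x else v $ i) \<in> nonzero_orth_reps ?F"
    if "v \<in> nonzero_orth_reps E" "x \<noteq> 0" "dot (v $ p) x = 0" for v and x :: "'k ^ 'd"
  proof -
    have "dot ((\<chi> i. if i = c then x else v $ i) $ i) ((\<chi> i. if i = c then x else v $ i) $ j) = 0"
      if ij: "{i, j} \<in> ?F" for i j
    proof (cases "{i, j} = {p, c}")
      case True
      then have "i = p \<and> j = c \<or> i = c \<and> j = p" by (auto simp: doubleton_eq_iff)
      then show ?thesis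
        using \<open>dot (v $ p) x = 0\<close> \<open>p \<noteq> c\<close> by (auto simp: dot_commute)
    next
      case False
      then have "{i, j} \<in> E" using ij by blast
      moreover from this have "i \<noteq> c" "j \<noteq> c" using leaf.hyps by blast+
      ultimately show ?thesis
        using \<open>v \<in> nonzero_orth_reps E\<close> by (simp add: nonzero_orth_reps_def orth_reps_def)
    qed
    then show ?thesis
      using that by (auto simp: nonzero_orth_reps_def orth_reps_def)
  qed
  show ?case
  proof (cases "c \<in> S")
    case False
    have "\<exists>v\<in>nonzero_orth_reps E. \<forall>s\<in>S. v $ s = a s"
      by (rule leaf.IH) (use leaf.prems sub in blast)+
    then obtain v where v: "v \<in> nonzero_orth_reps E" "\<forall>s\<in>S. v $ s = a s" by blast
    obtain x where x: "x \<noteq> 0" "dot (v $ p) x = 0"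
      using orthogonal_nonzero_exists[OF assms(2)] by blast
    show ?thesis
      using set_c[OF v(1) x] v(2) False by (intro bexI) auto
  next
    case True
    \<comment> \<open>The condition at \<open>c\<close> is replaced by one at \<open>p\<close>,
      which gets a vector orthogonal to \<open>a c\<close>. As \<open>p\<close> is joined to
      \<open>c\<close>, it is disconnected from the rest of \<open>S\<close>.\<close>
    obtain y where y: "y \<noteq> 0" "dot (a c) y = 0"
      using orthogonal_nonzero_exists[OF assms(2)] by blast
    have cp: "(c, p) \<in> (adj ?F)\<^sup>*" by (rule r_into_rtrancl) (simp add: adj_def insert_commute)
    have "p \<notin> S" using leaf.prems(1)[OF True] cp \<open>p \<noteq> c\<close> by blast
    have ps: "(p, s) \<notin> (adj E)\<^sup>*" if "s \<in> S - {c}" for s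
      using leaf.prems(1)[OF True, of s] that rtrancl_trans[OF cp, of s] sub by blast
    have "\<exists>v\<in>nonzero_orth_reps E. \<forall>s\<in>insert p (S - {c}). v $ s = (a(p := y)) s"
    proof (rule leaf.IH)
      fix s t assume st: "s \<in> insert p (S - {c})" "t \<in> insert p (S - {c})" "s \<noteq> t"
      show "(s, t) \<notin> (adj E)\<^sup>*"
      proof (cases "s = p \<or> t = p")
        case True
        then show ?thesis using st ps conn_sym[of s t E] by blast
      next
        case False
        then show ?thesis using st leaf.prems(1)[of s t] sub by blast
      qed
    qed (use y leaf.prems(2) in auto)
    then obtain v where v: "v \<in> nonzero_orth_reps E" "\<And>s. s \<in> insert p (S - {c}) \<Longrightarrow> v $ s = (a(p := y)) s"
      by blast
    have "v $ p = y" using v(2)[of p] by simp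
    then have "(\<chi> i. if i = c then a c else v $ i) \<in> nonzero_orth_reps ?F"
      using v(1) y True leaf.prems(2) by (intro set_c) (auto simp: dot_commute)
    moreover have "\<forall>s\<in>S. (\<chi> i. if i = c then a c else v $ i) $ s = a s"
      using v(2) \<open>p \<notin> S\<close> by auto
    ultimately show ?thesis by blast
  qed
qed

lemma mvar_notin_p_empty:
  assumes "acyclic_graph E" "CARD('d::finite) \<ge> 2"
  shows "mvar (i, k) \<notin> (p_empty E :: ('n::finite \<times> 'd, 'k::field) mpoly set)"
proof -
  obtain v :: "'k ^ 'd ^ 'n" where v: "v \<in> nonzero_orth_reps E" "\<forall>s\<in>{i}. v $ s = axis k 1"
    using nonzero_orth_reps_extend[OF assms, of "{i}" "\<lambda>_. axis k 1"] by (auto simp: axis_eq_0_iff)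
  then have "mpoly_eval (coords v) (mvar (i, k)) \<noteq> 0"
    by (simp add: axis_def)
  then show ?thesis using v(1) unfolding p_empty_iff by blast
qed

lemma prod_mvar_notin_p_empty:
  assumes "acyclic_graph E" "CARD('d::finite) \<ge> 2"
  shows "(\<Prod>i\<in>S. mvar (i, k)) \<notin> (p_empty E :: ('n::finite \<times> 'd, 'k::alg_closed_field) mpoly set)"
proof (induction S rule: infinite_finite_induct)
  case (insert j S)
  then show ?case
    using p_empty_prime[OF assms(1) mvar_notin_p_empty[OF assms] insert.IH, of j k] by simp
next
  case empty
  have "1 \<notin> (p_empty E :: ('n \<times> 'd, 'k) mpoly set)"
    using p_empty_mult_left[of 1 E "mvar (undefined, k)"] mvar_notin_p_empty[OF assms] by auto
  then show ?case by simp
next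
  case (infinite S)
  then show ?case by simp
qed

section \<open>Elimination\<close>

lemma ideal_power_diff:
  assumes "a - b \<in> ideal_generated S"
  shows "a ^ n - b ^ n \<in> ideal_generated S"
proof (induction n)
  case (Suc n)
  have "a ^ Suc n - b ^ Suc n = a * (a ^ n - b ^ n) + (a - b) * b ^ n"
    by (simp add: algebra_simps)
  then show ?case
    using Suc assms by (metis ideal_add ideal_mult_left ideal_mult_right)
qed simp

lemma mvar_power: "mvar x ^ n = Poly_Mapping.single (Poly_Mapping.single x n) 1"
  by (induction n) (simp_all add: mvar_def mult_single flip: single_add)

text \<open>Modulo the edge polynomial, \<open>mvar (p, k) * mvar (c, k)\<close> equals minus the
  sum of the other products, which is free of \<open>(c, k)\<close>. So a power of
  \<open>mvar (p, k)\<close> clears this variable from \<open>g\<close>.\<close>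

lemma leaf_coord_elimination:
  fixes g :: "('n::finite \<times> 'd::finite, 'k::comm_ring_1) mpoly"
  assumes "p \<noteq> c"
  shows "\<exists>N g'. g' \<in> polys_in (- {(c, k)}) \<and> mvar (p, k) ^ N * g - g' \<in> ideal_generated {edge_poly p c}"
proof (induction g rule: poly_mapping_induct_add)
  case (single m b)
  let ?I = "ideal_generated {edge_poly p c :: ('n \<times> 'd, 'k) mpoly}"
  define t where "t = Poly_Mapping.lookup m (c, k)"
  define n where "n = m - Poly_Mapping.single (c, k) t"
  define r :: "('n \<times> 'd, 'k) mpoly" where "r = - (\<Sum>l\<in>UNIV - {k}. mvar (p, l) * mvar (c, l))"
  have m: "Poly_Mapping.single (c, k) t + n = m"
    unfolding n_def by (rule poly_mapping_eqI) (auto simp: lookup_add lookup_minus lookup_single when_def t_def)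
  have n: "Poly_Mapping.lookup n (c, k) = 0"
    by (simp add: n_def lookup_minus t_def)
  have "mvar (p, k) * mvar (c, k) - r = edge_poly p c"
    unfolding edge_poly_def r_def by (simp add: sum.remove[of UNIV k])
  then have "(mvar (p, k) * mvar (c, k)) ^ t - r ^ t \<in> ?I"
    by (intro ideal_power_diff) (simp add: ideal_base)
  then have "((mvar (p, k) * mvar (c, k)) ^ t - r ^ t) * Poly_Mapping.single n b \<in> ?I"
    by (rule ideal_mult_right)
  moreover have "Poly_Mapping.single m b = mvar (c, k) ^ t * Poly_Mapping.single n b"
    by (simp add: mvar_power mult_single m)
  ultimately have "mvar (p, k) ^ t * Poly_Mapping.single m b - r ^ t * Poly_Mapping.single n b \<in> ?I"
    by (simp add: power_mult_distrib left_diff_distrib mult.assoc)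
  moreover have "r ^ t * Poly_Mapping.single n b \<in> polys_in (- {(c, k)})"
  proof (rule polys_in_mult)
    show "r ^ t \<in> polys_in (- {(c, k)})"
      unfolding r_def using assms
      by (intro polys_in_power polys_in_uminus polys_in_sum polys_in_mult polys_in_mvar) auto
    show "Poly_Mapping.single n b \<in> polys_in (- {(c, k)})"
      using n by (auto simp: polys_in_def in_keys_iff)
  qed
  ultimately show ?case by blast
next
  case (add f g)
  let ?I = "ideal_generated {edge_poly p c :: ('n \<times> 'd, 'k) mpoly}"
  let ?x = "mvar (p, k) :: ('n \<times> 'd, 'k) mpoly"
  obtain N1 f' where f: "f' \<in> polys_in (- {(c, k)})" "?x ^ N1 * f - f' \<in> ?I"
    using add.IH by blast
  obtain N2 g' where g: "g' \<in> polys_in (- {(c, k)})" "?x ^ N2 * g - g' \<in> ?I"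
    using add.IH by blast
  have "?x ^ (N1 + N2) * (f + g) - (?x ^ N2 * f' + ?x ^ N1 * g')
      = ?x ^ N2 * (?x ^ N1 * f - f') + ?x ^ N1 * (?x ^ N2 * g - g')"
    by (simp add: power_add algebra_simps)
  then have "?x ^ (N1 + N2) * (f + g) - (?x ^ N2 * f' + ?x ^ N1 * g') \<in> ?I"
    using f(2) g(2) by (metis ideal_add ideal_mult_left)
  moreover have "?x ^ N2 * f' + ?x ^ N1 * g' \<in> polys_in (- {(c, k)})"
    using f(1) g(1) assms by (intro polys_in_add polys_in_mult polys_in_power polys_in_mvar) auto
  ultimately show ?case by blast
qed

text \<open>Starting from a point for \<open>E\<close>, only the coordinate \<open>k\<close> of the
  vector of \<open>c\<close> is changed, so as to make it orthogonal to that of \<open>p\<close>;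
  \<open>g\<close> does not see this change.\<close>

lemma p_empty_leaf_elim:
  fixes g :: "('n::finite \<times> 'd::finite, 'k::alg_closed_field) mpoly"
  assumes E: "acyclic_graph E" and pc: "p \<noteq> c" and c: "\<And>e. e \<in> E \<Longrightarrow> c \<notin> e" and card: "CARD('d) \<ge> 2"
    and g: "g \<in> p_empty (insert {p, c} E)" "g \<in> polys_in (- {(c, k)})"
  shows "g \<in> p_empty E"
proof (rule ccontr)
  assume "g \<notin> p_empty E"
  obtain l where l: "l \<noteq> k"
    using card card_mono[of "{k}" "UNIV :: 'd set"] by fastforce
  \<comment> \<open>The factor \<open>mvar (p, k)\<close> makes the equation solvable for the new
    coordinate; \<open>mvar (c, l)\<close> with \<open>l \<noteq> k\<close> keeps the new vector
    nonzero.\<close>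
  have "g * mvar (p, k) * mvar (c, l) \<notin> p_empty E"
    by (intro p_empty_prime E mvar_notin_p_empty card) fact
  then obtain v where v: "v \<in> nonzero_orth_reps E" "mpoly_eval (coords v) (g * mvar (p, k) * mvar (c, l)) \<noteq> 0"
    by (auto simp: p_empty_iff)
  then have nz: "mpoly_eval (coords v) g \<noteq> 0" "v $ p $ k \<noteq> 0" "v $ c $ l \<noteq> 0"
    by (auto simp: mpoly_eval_mult)
  define x :: "'k ^ 'd" where
    "x = (\<chi> m. if m = k then - (\<Sum>m\<in>UNIV - {k}. v $ p $ m * v $ c $ m) / v $ p $ k else v $ c $ m)"
  define u where "u = (\<chi> i. if i = c then x else v $ i)"
  have px: "dot (v $ p) x = 0"
    unfolding dot_sum_remove[of _ _ k] using nz(2) by (simp add: x_def)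
  have "x $ l \<noteq> 0" using l nz(3) by (simp add: x_def)
  then have "x \<noteq> 0" by (metis zero_index)
  have "dot (u $ i) (u $ j) = 0" if ij: "{i, j} \<in> insert {p, c} E" for i j
  proof (cases "{i, j} = {p, c}")
    case True
    then have "i = p \<and> j = c \<or> i = c \<and> j = p" by (auto simp: doubleton_eq_iff)
    then show ?thesis
      using px pc by (auto simp: u_def dot_commute)
  next
    case False
    then have "{i, j} \<in> E" using ij by blast
    moreover from this have "i \<noteq> c" "j \<noteq> c" using c by blast+
    ultimately show ?thesis
      using v(1) by (simp add: nonzero_orth_reps_def orth_reps_def u_def)
  qed
  then have "u \<in> nonzero_orth_reps (insert {p, c} E)"
    using v(1) \<open>x \<noteq> 0\<close> by (auto simp: nonzero_orth_reps_def orth_reps_def u_def)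
  then have "mpoly_eval (coords u) g = 0" using g(1) by (simp add: p_empty_iff)
  moreover have "mpoly_eval (coords u) g = mpoly_eval (coords v) g"
  proof (rule mpoly_eval_cong[OF g(2)])
    show "coords u y = coords v y" if "y \<in> - {(c, k)}" for y
      using that by (cases y; cases "fst y = c") (simp_all add: u_def x_def)
  qed
  ultimately show False using nz(1) by simp
qed

text \<open>A power of \<open>mvar (p, k)\<close> trades \<open>g\<close> for some \<open>g'\<close>
  without the variable \<open>(c, k)\<close>; this \<open>g'\<close> lies in the prime of the graph
  without the leaf edge, where the induction hypothesis applies.\<close>

lemma p_empty_saturation:
  fixes E :: "'n::finite set set" and g :: "('n \<times> 'd::finite, 'k::alg_closed_field) mpoly"
  assumes "acyclic_graph E" "CARD('d) \<ge> 2" "g \<in> p_empty E"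
  shows "\<exists>N. (\<Prod>i\<in>UNIV. mvar (i, k)) ^ N * g \<in> lss_ideal E"
  using assms(1,3)
proof (induction E arbitrary: g rule: acyclic_graph_leaf_induct)
  case empty
  \<comment> \<open>Where all coordinates \<open>k\<close> are nonzero, so are all vectors, and
    \<open>g\<close> vanishes; elsewhere the product does.\<close>
  have "(\<Prod>i\<in>UNIV. mvar (i, k)) * g = 0"
  proof (rule mpoly_vanishing_eq_zero[OF infinite_UNIV_alg_closed_field])
    fix a :: "'n \<times> 'd \<Rightarrow> 'k"
    define v :: "'k ^ 'd ^ 'n" where "v = (\<chi> i k. a (i, k))"
    have a: "a = coords v" by (auto simp: v_def)
    show "mpoly_eval a ((\<Prod>i\<in>UNIV. mvar (i, k)) * g) = 0"
    proof (cases "\<forall>i. v $ i $ k \<noteq> 0")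
      case True
      then have "v $ i \<noteq> 0" for i by (metis zero_index)
      then have "v \<in> nonzero_orth_reps {}" by (simp add: nonzero_orth_reps_def orth_reps_def)
      then show ?thesis using empty by (simp add: p_empty_iff a mpoly_eval_mult)
    next
      case False
      then show ?thesis by (auto simp: a mpoly_eval_mult mpoly_eval_prod)
    qed
  qed
  then have "(\<Prod>i\<in>UNIV. mvar (i, k)) ^ 1 * g \<in> lss_ideal {}"
    by (simp add: lss_ideal_def)
  then show ?case by blast
next
  case (leaf E p c)
  let ?F = "insert {p, c} E"
  let ?x = "mvar (p, k) :: ('n \<times> 'd, 'k) mpoly"
  let ?X = "\<Prod>i\<in>UNIV. mvar (i, k) :: ('n \<times> 'd, 'k) mpoly"
  obtain N g' where g': "g' \<in> polys_in (- {(c, k)})" "?x ^ N * g - g' \<in> ideal_generated {edge_poly p c}"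
    using leaf_coord_elimination[OF \<open>p \<noteq> c\<close>] by blast
  have "{edge_poly p c} \<subseteq> edge_polys ?F" by (auto simp: edge_polys_def)
  then have diff: "?x ^ N * g - g' \<in> lss_ideal ?F"
    using g'(2) ideal_mono unfolding lss_ideal_edge_polys by blast
  have "?x ^ N * g - (?x ^ N * g - g') \<in> p_empty ?F"
    by (intro p_empty_diff p_empty_mult_left leaf.prems subsetD[OF lss_ideal_subset_p_empty diff])
  then have "g' \<in> p_empty ?F" by simp
  then have "g' \<in> p_empty E"
    using p_empty_leaf_elim[OF leaf.hyps(1,3,4) assms(2) _ g'(1)] by blast
  then obtain M where "?X ^ M * g' \<in> lss_ideal E" using leaf.IH by blast
  then have M: "?X ^ M * g' \<in> lss_ideal ?F" using lss_ideal_mono[of E ?F] by blast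
  \<comment> \<open>Splitting off the factor of \<open>p\<close> exhibits the power
    \<open>?x ^ N\<close> inside \<open>?X ^ N\<close>.\<close>
  have "?X = ?x * (\<Prod>i\<in>UNIV - {p}. mvar (i, k))" by (rule prod.remove) auto
  then have "?X ^ (M + N) * g = (\<Prod>i\<in>UNIV - {p}. mvar (i, k)) ^ N * (?X ^ M * (?x ^ N * g))"
    by (simp add: power_add power_mult_distrib algebra_simps)
  also have "?X ^ M * (?x ^ N * g) = ?X ^ M * (?x ^ N * g - g') + ?X ^ M * g'"
    by (simp add: algebra_simps)
  finally have "?X ^ (M + N) * g = (\<Prod>i\<in>UNIV - {p}. mvar (i, k)) ^ N
    * (?X ^ M * (?x ^ N * g - g') + ?X ^ M * g')" .
  then have "?X ^ (M + N) * g \<in> lss_ideal ?F"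
    using diff M unfolding lss_ideal_def by (simp add: ideal_add ideal_mult_left)
  then show ?case by blast
qed

lemma heavy_prod_mult_p_empty:
  fixes E :: "'n::finite set set" and g :: "('n \<times> 'd::finite, 'k::alg_closed_field) mpoly"
  assumes "acyclic_graph E" "CARD('d) \<ge> 2" "g \<in> p_empty E"
  shows "(\<Prod>i\<in>{i. vertex_degree E i \<ge> CARD('d)}. mvar (i, k)) * g \<in> lss_ideal E"
  using p_empty_saturation[OF assms, of k] coord_prod_saturated[OF assms(1), of k UNIV] by auto


section \<open>The localized v-number\<close>

lemma homogeneous_part_weight_hom: "f \<in> homogeneous_part e \<longleftrightarrow> weight_hom (\<lambda>_. 1) (int e) f"
proof -
  have "mon_degree m = (\<Sum>x\<in>UNIV. Poly_Mapping.lookup m x)" for m :: "'a::finite \<Rightarrow>\<^sub>0 nat"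
    unfolding mon_degree_def by (rule sum.mono_neutral_left) (auto simp: in_keys_iff)
  then have "weight_degree (\<lambda>_. 1) m = int (mon_degree m)" for m :: "'a::finite \<Rightarrow>\<^sub>0 nat"
    by (simp add: weight_degree_def)
  then show ?thesis by (simp add: homogeneous_part_def weight_hom_def)
qed

lemma weight_degree_row_sum:
  fixes m :: "'n::finite \<times> 'd::finite \<Rightarrow>\<^sub>0 nat"
  shows "weight_degree (\<lambda>_. 1) m = (\<Sum>i\<in>UNIV. weight_degree (row_weight i) m)"
proof -
  have "(\<Sum>i\<in>UNIV. row_weight i x) = 1" for x :: "'n \<times> 'd"
    by (cases x) simp
  then show ?thesis
    unfolding weight_degree_def by (subst sum.swap) (simp flip: sum_distrib_left)
qed

lemma polys_in_iff_weight_hom_row: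
  fixes f :: "('n::finite \<times> 'd::finite, 'k::comm_ring_1) mpoly"
  shows "f \<in> polys_in {(j, k). j \<noteq> i} \<longleftrightarrow> weight_hom (row_weight i) 0 f"
proof -
  have "Poly_Mapping.keys m \<subseteq> {(j, k). j \<noteq> i} \<longleftrightarrow> weight_degree (row_weight i) m = 0" for m :: "'n \<times> 'd \<Rightarrow>\<^sub>0 nat"
  proof -
    have "weight_degree (row_weight i) m = 0 \<longleftrightarrow> (\<forall>x\<in>UNIV. int (Poly_Mapping.lookup m x) * row_weight i x = 0)"
      unfolding weight_degree_def by (rule sum_nonneg_eq_0_iff) (auto simp: row_weight_def split: prod.splits)
    then show ?thesis by (auto simp: in_keys_iff subset_iff)
  qed
  then show ?thesis by (simp add: polys_in_def weight_hom_def)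
qed

text \<open>Rescaling the vector of one vertex by a nonzero scalar preserves orthogonality and
  nonvanishing, so the prime is homogeneous for the row grading.\<close>

lemma p_empty_graded_part_row:
  fixes f :: "('n::finite \<times> 'd::finite, 'k::alg_closed_field) mpoly"
  assumes "f \<in> p_empty E"
  shows "graded_part (row_weight i) 0 f \<in> p_empty E"
  unfolding p_empty_iff
proof
  fix v :: "'k ^ 'd ^ 'n" assume v: "v \<in> nonzero_orth_reps E"
  define w :: "'n \<times> 'd \<Rightarrow> nat" where "w = (\<lambda>(j, k). if j = i then 1 else 0)"
  have w: "(\<lambda>x. int (w x)) = row_weight i" by (auto simp: w_def row_weight_def)
  have "mpoly_eval (coords v) (graded_part (\<lambda>x. int (w x)) (int 0) f) = 0"
  proof (rule mpoly_eval_graded_part_eq_zero)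
    show "infinite (UNIV - {0 :: 'k})" using infinite_UNIV_alg_closed_field by simp
    fix s :: 'k assume s: "s \<in> UNIV - {0}"
    define u :: "'k ^ 'd ^ 'n" where "u = (\<chi> j k. s ^ w (j, k) * v $ j $ k)"
    have eq: "(\<lambda>x. s ^ w x * coords v x) = coords u" by (auto simp: u_def)
    have u: "u $ j = (\<chi> k. (if j = i then s else 1) * v $ j $ k)" for j
      by (simp add: u_def w_def vec_eq_iff)
    have "u $ j \<noteq> 0" for j
      using v s by (auto simp: u vec_eq_iff nonzero_orth_reps_def)
    moreover have "dot (u $ j) (u $ l)
      = (if j = i then s else 1) * (if l = i then s else 1) * dot (v $ j) (v $ l)" for j l
      unfolding u dot_def sum_distrib_left by (rule sum.cong) (auto simp: mult_ac)
    ultimately have "u \<in> nonzero_orth_reps E"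
      using v by (simp add: nonzero_orth_reps_def orth_reps_def)
    then show "mpoly_eval (\<lambda>x. s ^ w x * coords v x) f = 0"
      unfolding eq using assms by (simp add: p_empty_iff)
  qed
  then show "mpoly_eval (coords v) (graded_part (row_weight i) 0 f) = 0" by (simp add: w)
qed

text \<open>
  Vectors orthogonal to a common nonzero vector are dependent, so the determinant of \<open>CARD('d)\<close>
  neighbours of \<open>i\<close> lies in \<open>p_empty E\<close>, but it does not vanish once \<open>i\<close> is removed.
\<close>

lemma heavy_row_graded_part_in_p_empty:
  fixes E :: "'n::finite set set" and f :: "('n \<times> 'd::finite, 'k::alg_closed_field) mpoly"
  assumes E: "acyclic_graph E" and card: "CARD('d) \<ge> 2" and deg: "vertex_degree E i \<ge> CARD('d)"
    and f: "\<And>g. g \<in> p_empty E \<Longrightarrow> f * g \<in> lss_ideal E"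
  shows "graded_part (row_weight i) 0 f \<in> p_empty E"
proof -
  \<comment> \<open>The chosen neighbours are indexed by the coordinates, so that their vectors form
    a square matrix.\<close>
  obtain \<nu> :: "'d \<Rightarrow> 'n" where \<nu>: "inj \<nu>" "range \<nu> \<subseteq> {j. {i, j} \<in> E}"
    using deg card_le_inj[of "UNIV :: 'd set" "{j. {i, j} \<in> E}"] by (auto simp: vertex_degree_def)
  have edge: "{i, \<nu> j} \<in> E" for j using \<nu>(2) by auto
  have \<nu>i: "\<nu> j \<noteq> i" for j using acyclic_graph_neq[OF E edge[of j]] by simp
  define F where "F = {e \<in> E. i \<notin> e}"
  have F: "acyclic_graph F" using E by (rule acyclic_graph_subset) (auto simp: F_def)
  define D :: "('n \<times> 'd, 'k) mpoly" where "D = det (\<chi> j k. mvar (\<nu> j, k))"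
  have eval_D: "mpoly_eval (coords v) D = det (\<chi> j. v $ \<nu> j)" for v
    unfolding D_def mpoly_eval_det by (intro arg_cong[of _ _ det]) (simp add: vec_eq_iff)
  have D_row: "D \<in> polys_in {(j, k). j \<noteq> i}"
  proof -
    have "of_int (sign p) \<in> polys_in {(j, k). j \<noteq> i}" for p :: "'d \<Rightarrow> 'd"
      by (auto simp: sign_def intro: polys_in_uminus)
    then show ?thesis
      unfolding D_def det_def using \<nu>i
      by (intro polys_in_sum polys_in_mult polys_in_prod) (auto intro: polys_in_mvar)
  qed
  have "D \<in> p_empty E"
    unfolding p_empty_iff eval_D
  proof
    fix v :: "'k ^ 'd ^ 'n" assume v: "v \<in> nonzero_orth_reps E"
    let ?A = "\<chi> j. v $ \<nu> j"
    have "dot (v $ \<nu> j) (v $ i) = 0" for j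
      using v edge[of j] by (simp add: nonzero_orth_reps_def orth_reps_def insert_commute)
    then have "?A *v (v $ i) = 0"
      by (simp add: matrix_vector_mult_def dot_def vec_eq_iff)
    moreover have "v $ i \<noteq> 0" using v by (simp add: nonzero_orth_reps_def)
    ultimately have "\<not> invertible ?A"
      by (metis invertible_def matrix_vector_mul_assoc matrix_vector_mul_lid matrix_vector_mult_0_right)
    then show "det ?A = 0" by (simp add: invertible_det_nz)
  qed
  moreover have "D \<notin> p_empty F"
  proof -
    \<comment> \<open>Without \<open>i\<close> its neighbours lie in different components: otherwise
      a path from \<open>s\<close> to \<open>t\<close> followed by the edge to \<open>i\<close>
      would bypass the edge \<open>{i, s}\<close>. Hence unit vectors can be prescribed
      there.\<close>
    have "(s, t) \<notin> (adj F)\<^sup>*" if "s \<in> range \<nu>" "t \<in> range \<nu>" "s \<noteq> t" for s t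
    proof
      assume "(s, t) \<in> (adj F)\<^sup>*"
      moreover have "F \<subseteq> E - {{i, s}}" by (auto simp: F_def)
      ultimately have "(s, t) \<in> (adj (E - {{i, s}}))\<^sup>*" using adj_mono by blast
      moreover have "{t, i} \<in> E - {{i, s}}"
        using that edge by (auto simp: doubleton_eq_iff insert_commute)
      ultimately have "(i, s) \<in> (adj (E - {{i, s}}))\<^sup>*"
        by (intro conn_sym[of s i]) (rule conn_step)
      moreover have "{i, s} \<in> E" using that edge by auto
      ultimately show False using E by (auto simp: acyclic_graph_def)
    qed
    then obtain v :: "'k ^ 'd ^ 'n" where v: "v \<in> nonzero_orth_reps F"
      "\<forall>s\<in>range \<nu>. v $ s = axis (inv \<nu> s) 1"
      using nonzero_orth_reps_extend[OF F card, of "range \<nu>" "\<lambda>s. axis (inv \<nu> s) 1"]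
      by (auto simp: axis_eq_0_iff)
    have "(\<chi> j. v $ \<nu> j) = mat 1"
      using v(2) \<nu>(1) by (simp add: vec_eq_iff mat_def axis_def)
    then have "mpoly_eval (coords v) D \<noteq> 0" by (simp add: eval_D)
    then show ?thesis using v(1) unfolding p_empty_iff by blast
  qed
  moreover have "graded_part (row_weight i) 0 f * D \<in> p_empty F" if D: "D \<in> p_empty E"
    unfolding p_empty_iff
  proof
    fix v :: "'k ^ 'd ^ 'n" assume v: "v \<in> nonzero_orth_reps F"
    \<comment> \<open>With the zero vector at \<open>i\<close>, \<open>u\<close> is a point of
      \<open>orth_reps E\<close> outside \<open>nonzero_orth_reps E\<close>, and elements of
      \<open>lss_ideal E\<close> vanish there as well. The product considered is free of row
      \<open>i\<close>, so its values at \<open>u\<close> and \<open>v\<close> agree.\<close>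
    define u where "u = (\<chi> j. if j = i then 0 else v $ j)"
    have "dot (u $ j) (u $ l) = 0" if "{j, l} \<in> E" for j l
    proof (cases "j = i \<or> l = i")
      case True
      then show ?thesis by (auto simp: u_def dot_def)
    next
      case False
      then show ?thesis
        using that v by (auto simp: u_def F_def nonzero_orth_reps_def orth_reps_def)
    qed
    then have u: "u \<in> orth_reps E" by (simp add: orth_reps_def)
    have "graded_part (row_weight i) 0 (f * D) = graded_part (row_weight i) 0 f * D"
      using D_row by (subst graded_part_mult[where b = 0]) (auto simp: polys_in_iff_weight_hom_row)
    moreover have "graded_part (row_weight i) 0 (f * D) \<in> lss_ideal E"
      using f[OF D] unfolding lss_ideal_edge_polys
      by (rule graded_part_ideal) (use weight_hom_row_edge_poly in \<open>unfold edge_polys_def, blast\<close>)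
    ultimately have "mpoly_eval (coords u) (graded_part (row_weight i) 0 f * D) = 0"
      using u mpoly_eval_lss_ideal by metis
    moreover have "mpoly_eval (coords u) (graded_part (row_weight i) 0 f * D)
        = mpoly_eval (coords v) (graded_part (row_weight i) 0 f * D)"
    proof (rule mpoly_eval_cong)
      show "graded_part (row_weight i) 0 f * D \<in> polys_in {(j, k). j \<noteq> i}"
        using D_row weight_hom_graded_part[of "row_weight i" 0 f] by (intro polys_in_mult) (simp_all add: polys_in_iff_weight_hom_row)
    qed (auto simp: u_def)
    ultimately show "mpoly_eval (coords v) (graded_part (row_weight i) 0 f * D) = 0" by simp
  qed
  ultimately have "graded_part (row_weight i) 0 f \<in> p_empty F"
    using p_empty_prime[OF F] by blast
  then show ?thesis using p_empty_mono[of F E] by (auto simp: F_def)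
qed

section \<open>Lower bound on the degree, and conclusion\<close>

lemma p_empty_heavy_degree:
  fixes E :: "'n::finite set set" and f :: "('n \<times> 'd::finite, 'k::alg_closed_field) mpoly"
  assumes E: "acyclic_graph E" and card: "CARD('d) \<ge> 2" and hom: "f \<in> homogeneous_part e"
    and fp: "f \<notin> p_empty E" and f: "\<And>g. g \<in> p_empty E \<Longrightarrow> f * g \<in> lss_ideal E"
  shows "num_vertices_degree_ge (CARD('d)) E \<le> e"
proof -
  let ?H = "{i. vertex_degree E i \<ge> CARD('d)}"
  have "\<exists>h. f - h \<in> p_empty E \<and> weight_hom (\<lambda>_. 1) (int e) h
      \<and> (\<forall>m\<in>Poly_Mapping.keys h. \<forall>i\<in>S. weight_degree (row_weight i) m \<ge> 1)"
    if "finite S" "S \<subseteq> ?H" for S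
    using that
  proof (induction S)
    case empty
    have "f - f \<in> p_empty E" by (simp add: p_empty_iff)
    then show ?case using hom unfolding homogeneous_part_weight_hom by blast
  next
    case (insert i S)
    then obtain h where h: "f - h \<in> p_empty E" "weight_hom (\<lambda>_. 1) (int e) h"
      "\<forall>m\<in>Poly_Mapping.keys h. \<forall>i\<in>S. weight_degree (row_weight i) m \<ge> 1" by auto
    let ?c = "graded_part (row_weight i) 0"
    have "?c f \<in> p_empty E"
      using insert.prems f by (intro heavy_row_graded_part_in_p_empty[OF E card]) auto
    \<comment> \<open>The part of \<open>h\<close> free of \<open>i\<close> is the difference of
      those of \<open>f\<close> and \<open>f - h\<close>, both in the prime, so it may be dropped
      from \<open>h\<close>.\<close>
    then have "?c f - ?c (f - h) \<in> p_empty E"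
      using p_empty_graded_part_row[OF h(1)] by (rule p_empty_diff)
    then have "(f - h) + ?c h \<in> p_empty E"
      using h(1) by (intro p_empty_add) (simp_all add: graded_part_diff)
    moreover have "weight_hom (\<lambda>_. 1) (int e) (h - ?c h)"
      by (intro weight_hom_diff weight_hom_graded_part_other h(2))
    moreover have "\<forall>m\<in>Poly_Mapping.keys (h - ?c h). \<forall>j\<in>insert i S. weight_degree (row_weight j) m \<ge> 1"
    proof (intro ballI)
      fix m j assume m: "m \<in> Poly_Mapping.keys (h - ?c h)" and j: "j \<in> insert i S"
      then have "m \<in> Poly_Mapping.keys h" "weight_degree (row_weight i) m \<noteq> 0"
        by (auto simp: in_keys_iff lookup_minus lookup_graded_part split: if_splits)
      then show "weight_degree (row_weight j) m \<ge> 1"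
        using j h(3) row_weight_nonneg[of i m] by force
    qed
    ultimately show ?case
      by (intro exI[of _ "h - ?c h"]) (simp add: algebra_simps)
  qed
  from this[of ?H] obtain h where h: "f - h \<in> p_empty E" "weight_hom (\<lambda>_. 1) (int e) h"
      "\<forall>m\<in>Poly_Mapping.keys h. \<forall>i\<in>?H. weight_degree (row_weight i) m \<ge> 1" by auto
  have "h \<noteq> 0" using h(1) fp by auto
  then obtain m where m: "m \<in> Poly_Mapping.keys h"
    by (metis in_keys_iff lookup_zero poly_mapping_eqI)
  have "int (num_vertices_degree_ge (CARD('d)) E) = (\<Sum>i\<in>?H. 1)"
    by (simp add: num_vertices_degree_ge_def)
  also have "\<dots> \<le> (\<Sum>i\<in>?H. weight_degree (row_weight i) m)"
    using h(3) m by (intro sum_mono) auto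
  also have "\<dots> \<le> (\<Sum>i\<in>UNIV. weight_degree (row_weight i) m)"
    by (intro sum_mono2) (auto simp: row_weight_nonneg)
  also have "\<dots> = int e"
    using h(2) m by (simp add: weight_hom_def flip: weight_degree_row_sum)
  finally show ?thesis by simp
qed

theorem theorem4p9:
  fixes E :: "'n::finite set set"
  assumes "forest E"
    and "CARD('d::finite) \<ge> 3"
  shows "localized_v_number
           (p_empty E :: ('n \<times> 'd, 'k::alg_closed_field) mpoly set)
           (lss_ideal E)
         = enat (num_vertices_degree_ge (CARD('d)) E)"
proof -
  let ?P = "p_empty E :: ('n \<times> 'd, 'k) mpoly set"
  let ?N = "num_vertices_degree_ge (CARD('d)) E"
  let ?H = "{i. vertex_degree E i \<ge> CARD('d)}"
  have E: "acyclic_graph E" using assms(1) by (rule forest_acyclic_graph)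
  have card: "CARD('d) \<ge> 2" using assms(2) by simp
  \<comment> \<open>One arbitrary coordinate is fixed and used at every heavy vertex.\<close>
  define s :: "('n \<times> 'd, 'k) mpoly" where "s = (\<Prod>i\<in>?H. mvar (i, undefined))"
  have sP: "s * g \<in> lss_ideal E" if "g \<in> ?P" for g
    unfolding s_def using E card that by (rule heavy_prod_mult_p_empty)
  have s_notin: "s \<notin> ?P"
    unfolding s_def using E card by (rule prod_mvar_notin_p_empty)
  have s_hom: "s \<in> homogeneous_part ?N"
  proof -
    have "weight_hom (\<lambda>_. 1) (int (card S)) (\<Prod>i\<in>S. mvar (i, undefined) :: ('n \<times> 'd, 'k) mpoly)" for S :: "'n set"
    proof (induction S rule: infinite_finite_induct)
      case (insert j S)
      have "weight_hom (\<lambda>_. 1) 1 (mvar (j, undefined) :: ('n \<times> 'd, 'k) mpoly)"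
        by (rule weight_hom_mvar) simp
      from weight_hom_mult[OF this insert.IH] show ?case using insert.hyps by simp
    qed auto
    then show ?thesis by (simp add: s_def homogeneous_part_weight_hom num_vertices_degree_ge_def)
  qed
  have "colon_ideal (lss_ideal E) s = ?P"
  proof (intro equalityI subsetI)
    fix g assume "g \<in> colon_ideal (lss_ideal E) s"
    then have "g * s \<in> ?P"
      using lss_ideal_subset_p_empty by (auto simp: colon_ideal_def)
    then show "g \<in> ?P" using p_empty_prime[OF E _ s_notin] by blast
  next
    fix g assume "g \<in> ?P"
    then show "g \<in> colon_ideal (lss_ideal E) s"
      using sP by (simp add: colon_ideal_def mult.commute)
  qed
  then have upper: "localized_v_number ?P (lss_ideal E) \<le> enat ?N"
    unfolding localized_v_number_def using s_hom by (intro Inf_lower) blast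
  have lower: "?N \<le> e" if f: "f \<in> homogeneous_part e" "colon_ideal (lss_ideal E) f = ?P" for e f
  proof (rule p_empty_heavy_degree[OF E card f(1)])
    \<comment> \<open>Otherwise \<open>s * f\<close> would lie in the ideal, putting
      \<open>s\<close> into the colon ideal, that is, into the prime.\<close>
    show "f \<notin> ?P"
    proof
      assume "f \<in> ?P"
      then have "s \<in> colon_ideal (lss_ideal E) f" using sP by (simp add: colon_ideal_def)
      then show False using s_notin f(2) by simp
    qed
    show "f * g \<in> lss_ideal E" if "g \<in> ?P" for g
      using that f(2) by (auto simp: colon_ideal_def mult.commute)
  qed
  then have "enat ?N \<le> localized_v_number ?P (lss_ideal E)"
    unfolding localized_v_number_def by (intro Inf_greatest) auto
  then show ?thesis using upper by (rule antisym[rotated])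
qed

end
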